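(* Let $\theta\in[0,2\pi]$ be an irrational multiple of $2\pi$ and let $\lambda>0$. Let $$R_\theta=\begin{bmatrix}\cos\theta&-\sin\theta\\ \sin\theta&\cos\theta\end{bmatrix},\qquad A_\lambda=\begin{bmatrix}e^{\lambda}&0\\0&e^{-\lambda}\end{bmatrix},$$ let $\Gamma_{\theta,\lambda}$ be the subgroup of $\mathrm{SL}_2(\mathbb R)\times\mathrm{SL}_2(\mathbb R)$ generated by $(R_\theta,A_\lambda)$ and $(A_\lambda,R_\theta)$, and let $\Delta_{\theta,\lambda}=\langle R_\theta,A_\lambda\rangle<\mathrm{SL}_2(\mathbb R)$ be the projection of $\Gamma_{\theta,\lambda}$ to the first factor (equivalently, to the second factor, the two projections being the same subgroup). If $\Gamma_{\theta,\lambda}$ is discrete, then $\Delta_{\theta,\lambda}$ is strongly diophantine.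
   Context: Let $G$ be a semi-simple Lie group (here $G=\mathrm{SL}_2(\mathbb R)$) with a fixed left-invariant (Riemannian) metric $d$, and let $B_G(g,r)$ denote the metric ball of radius $r\ge 0$ centered at $g\in G$. Let $\Gamma\subset G$ be a finitely generated dense subgroup with finite generating set $S$, and let $S^n$ denote the set of elements of $\Gamma$ that can be written as words of length at most $n$ in $S\cup S^{-1}$. The group $\Gamma$ is called strongly diophantine if there exist $c_1,c_2>0$ such that $B_G(1_G,c_1e^{-c_2n})\cap S^n=\{1_G\}$ for all $n\ge 1$. This notion does not depend on the choice of $S$. *)

theory Defs
  imports "HOL-Analysis.Analysis" "HOL-Algebra.Generated_Groups"
begin

text \<open>
  The topology of \<open>SL2\<close> is the one it inherits from the space \<open>real^2^2\<close> of matrices, and that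
  of \<open>SL2 \<times>\<times> SL2\<close> is inherited from the product space.
\<close>

definition SL2 :: "(real^2^2) monoid" where
  "SL2 = \<lparr>carrier = {A. det A = 1}, mult = (**), one = mat 1\<rparr>"

lemma SL2_simps [simp]:
  "A \<in> carrier SL2 \<longleftrightarrow> det A = 1"
  "A \<otimes>\<^bsub>SL2\<^esub> B = A ** B"
  "\<one>\<^bsub>SL2\<^esub> = mat 1"
  by (simp_all add: SL2_def)

lemma group_SL2: "group SL2"
proof (rule groupI)
  fix A assume "A \<in> carrier SL2"
  then have A: "det A = 1" by simp
  then obtain B where B: "B ** A = mat 1"
    by (metis invertible_def invertible_det_nz zero_neq_one)
  then have "det B = 1"
    by (metis A det_I det_mul mult.right_neutral)
  with B show "\<exists>B\<in>carrier SL2. B \<otimes>\<^bsub>SL2\<^esub> A = \<one>\<^bsub>SL2\<^esub>"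
    by auto
qed (simp_all add: det_mul matrix_mul_assoc)

text \<open>
  A left-invariant Riemannian metric on \<open>SL2\<close> is given by an inner product \<open>Q\<close> on its Lie algebra,
  the space \<open>sl2\<close> of trace-zero matrices. It is convenient to let \<open>Q\<close> be a bilinear form on all
  matrices, whose values off \<open>sl2\<close> are irrelevant; every inner product on \<open>sl2\<close> extends to such a form.
\<close>

definition sl2 :: "(real^2^2) set" where
  "sl2 = {X. trace X = 0}"

definition inner_product_on_sl2 :: "(real^2^2 \<Rightarrow> real^2^2 \<Rightarrow> real) \<Rightarrow> bool" where
  "inner_product_on_sl2 Q \<longleftrightarrow> bilinear Q \<and>
     (\<forall>X\<in>sl2. \<forall>Y\<in>sl2. Q X Y = Q Y X) \<and> (\<forall>X\<in>sl2. X \<noteq> 0 \<longrightarrow> Q X X > 0)"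

text \<open>
  The tangent vector \<open>\<gamma>'(t)\<close> is moved to the Lie algebra by left translation by \<open>\<gamma>(t)\<^sup>-\<^sup>1\<close>, and the
  distance is the infimum of the lengths of \<open>C\<^sup>1\<close> paths. Allowing piecewise \<open>C\<^sup>1\<close> paths
  would give the same infimum, but \<^const>\<open>valid_path\<close> would not do here: it places no bound
  on the derivative near the break points, so the speed may fail to be integrable, in which
  case \<^const>\<open>integral\<close> returns 0.
\<close>

definition path_length :: "(real^2^2 \<Rightarrow> real^2^2 \<Rightarrow> real) \<Rightarrow> (real \<Rightarrow> real^2^2) \<Rightarrow> real" where
  "path_length Q \<gamma> = integral {0..1}
     (\<lambda>t. let X = inv\<^bsub>SL2\<^esub> (\<gamma> t) ** vector_derivative \<gamma> (at t) in sqrt (Q X X))"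

definition SL2_dist :: "(real^2^2 \<Rightarrow> real^2^2 \<Rightarrow> real) \<Rightarrow> real^2^2 \<Rightarrow> real^2^2 \<Rightarrow> real" where
  "SL2_dist Q g h = Inf {path_length Q \<gamma> | \<gamma>.
     \<gamma> C1_differentiable_on {0..1} \<and> \<gamma> ` {0..1} \<subseteq> carrier SL2 \<and> \<gamma> 0 = g \<and> \<gamma> 1 = h}"

definition SL2_ball :: "(real^2^2 \<Rightarrow> real^2^2 \<Rightarrow> real) \<Rightarrow> real^2^2 \<Rightarrow> real \<Rightarrow> (real^2^2) set" where
  "SL2_ball Q g r = {h \<in> carrier SL2. SL2_dist Q g h < r}"

definition word_ball :: "('a, 'b) monoid_scheme \<Rightarrow> 'a set \<Rightarrow> nat \<Rightarrow> 'a set" where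
  "word_ball G S n =
     {foldr (\<otimes>\<^bsub>G\<^esub>) ws \<one>\<^bsub>G\<^esub> | ws. set ws \<subseteq> S \<union> m_inv G ` S \<and> length ws \<le> n}"

text \<open>
  Being strongly diophantine is a property of finitely generated dense subgroups. It does not depend on
  the finite generating set \<open>S\<close>; the definition asks for the estimate for every such \<open>S\<close>,
  and for the existence of one.
\<close>

definition strongly_diophantine :: "(real^2^2 \<Rightarrow> real^2^2 \<Rightarrow> real) \<Rightarrow> (real^2^2) set \<Rightarrow> bool" where
  "strongly_diophantine Q \<Gamma> \<longleftrightarrow>
     subgroup \<Gamma> SL2 \<and>
     carrier SL2 \<subseteq> closure \<Gamma> \<and>
     (\<exists>S. finite S \<and> S \<subseteq> carrier SL2 \<and> generate SL2 S = \<Gamma>) \<and>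
     (\<forall>S. finite S \<and> S \<subseteq> carrier SL2 \<and> generate SL2 S = \<Gamma> \<longrightarrow>
        (\<exists>c1>0. \<exists>c2>0. \<forall>n\<ge>1.
           SL2_ball Q \<one>\<^bsub>SL2\<^esub> (c1 * exp (- c2 * real n)) \<inter> word_ball SL2 S n = {\<one>\<^bsub>SL2\<^esub>}))"

definition rot :: "real \<Rightarrow> real^2^2" where
  "rot \<theta> = vector [vector [cos \<theta>, - sin \<theta>], vector [sin \<theta>, cos \<theta>]]"

definition hyp :: "real \<Rightarrow> real^2^2" where
  "hyp l = vector [vector [exp l, 0], vector [0, exp (- l)]]"

definition Gamma_sub :: "real \<Rightarrow> real \<Rightarrow> ((real^2^2) \<times> (real^2^2)) set" where
  "Gamma_sub \<theta> l = generate (SL2 \<times>\<times> SL2) {(rot \<theta>, hyp l), (hyp l, rot \<theta>)}"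

definition Delta_sub :: "real \<Rightarrow> real \<Rightarrow> (real^2^2) set" where
  "Delta_sub \<theta> l = generate SL2 {rot \<theta>, hyp l}"

lemma det_rot [simp]: "det (rot \<theta>) = 1"
  by (simp add: rot_def det_2 power2_eq_square [symmetric])

lemma det_hyp [simp]: "det (hyp l) = 1"
  by (simp add: hyp_def det_2 exp_minus)

lemma fst_Gamma_sub: "fst ` Gamma_sub \<theta> l = Delta_sub \<theta> l"
proof -
  interpret group_hom "SL2 \<times>\<times> SL2" SL2 fst
    by (auto intro!: group_hom.intro group_hom_axioms.intro DirProd_group group_SL2 homI)
  show ?thesis
    using generate_img[of "{(rot \<theta>, hyp l), (hyp l, rot \<theta>)}"]
    by (simp add: Gamma_sub_def Delta_sub_def)
qed

lemma snd_Gamma_sub: "snd ` Gamma_sub \<theta> l = Delta_sub \<theta> l"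
proof -
  interpret group_hom "SL2 \<times>\<times> SL2" SL2 snd
    by (auto intro!: group_hom.intro group_hom_axioms.intro DirProd_group group_SL2 homI)
  show ?thesis
    using generate_img[of "{(rot \<theta>, hyp l), (hyp l, rot \<theta>)}"]
    by (simp add: Gamma_sub_def Delta_sub_def insert_commute)
qed

end

theory Submission
  imports Defs
begin

text \<open>
  Suppose that a word \<open>g \<noteq> 1\<close> of length \<open>n\<close> in the generators of \<open>\<Delta>\<close> were closer to \<open>1\<close> than
  \<open>e^(-c n)\<close> for a huge \<open>c\<close>. It lifts to some \<open>(g, g') \<in> \<Gamma>\<close> with \<open>g'\<close> of norm at most \<open>C^n\<close>, over
  which there is no further control. Discreteness of \<open>\<Gamma>\<close> is brought to bear through commutators: if
  \<open>(x, y) \<in> \<Gamma>\<close> has \<open>x\<close> of norm at most \<open>E^n\<close> and \<open>y\<close> within \<open>D^(-n)\<close> of \<open>1\<close>, with \<open>D\<close> large compared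
  to \<open>C\<close> and then \<open>c\<close> large compared to \<open>E\<close>, both coordinates of the commutator of \<open>(g, g')\<close> and \<open>(x, y)\<close>
  are near \<open>1\<close>. So the commutator is trivial, and \<open>g\<close> commutes with \<open>x\<close>
  (lemma \<open>Gamma_sub_commute_if_small\<close>). The same applies to the conjugates of \<open>(x, y)\<close> by the two
  generators of \<open>\<Gamma>\<close>, so that \<open>g\<close> commutes with \<open>x\<close>, with \<open>R x R\<inverse>\<close> and with \<open>A x A\<inverse>\<close>, where
  \<open>R = rot \<theta>\<close> and \<open>A = hyp l\<close>. As \<open>g \<noteq> \<plusminus> 1\<close>, these three then commute with each other, which is possible
  only for \<open>x = \<plusminus> 1\<close> (lemma \<open>central_of_conjugates_commute\<close>).

  What has to be found is a pair \<open>(x, y)\<close> with \<open>x \<noteq> \<plusminus> 1\<close> and \<open>y\<close> exponentially close to \<open>1\<close> at an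
  arbitrarily prescribed rate (lemma \<open>Gamma_sub_small_second_coordinate\<close>). Here the asymmetry of the
  generators is used. The words of \<open>n\<close> letters in \<open>(A, R)^(N k) (s, s')\<close>, for a fixed \<open>(s, s') \<in> \<Gamma>\<close> and
  \<open>0 \<le> k < K\<close>, have second coordinates of norm at most \<open>2 B^n\<close>, where \<open>B\<close> does not depend on \<open>K\<close> because
  the powers of \<open>R\<close> are isometries. If \<open>s\<close> has positive entries and \<open>N\<close> is large, the first coordinates
  of these \<open>K^n\<close> words are distinct, by a ping-pong argument on the slopes of vectors in the positive
  quadrant (lemma \<open>word_product_inj\<close>). For large \<open>K\<close> there are more words than cells of side about
  \<open>(B D)^(-n)\<close> in a ball of radius \<open>2 B^n\<close> in the space of matrices; two words in the same cell have a
  quotient of the required kind.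

  The rest is the passage between the Riemannian distance and the matrix norm near \<open>1\<close>
  (lemma \<open>SL2_ball_norm_bound\<close>) and the density of \<open>\<Delta>\<close> (lemma \<open>Delta_sub_dense\<close>). Both rest on the
  Cartan decomposition.
\<close>

section \<open>Two by two matrices\<close>

definition mat2 :: "real \<Rightarrow> real \<Rightarrow> real \<Rightarrow> real \<Rightarrow> real^2^2" where
  "mat2 a b c d = vector [vector [a, b], vector [c, d]]"

lemma mat2_nth [simp]:
  "mat2 a b c d $ 1 $ 1 = a" "mat2 a b c d $ 1 $ 2 = b"
  "mat2 a b c d $ 2 $ 1 = c" "mat2 a b c d $ 2 $ 2 = d"
  by (simp_all add: mat2_def)

lemma mat2_eq_iff [simp]:
  "mat2 a b c d = mat2 a' b' c' d' \<longleftrightarrow> a = a' \<and> b = b' \<and> c = c' \<and> d = d'"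
  by (metis mat2_nth)

lemma mat2_cases [case_names mat2]:
  obtains a b c d where "A = mat2 a b c d"
proof
  show "A = mat2 (A$1$1) (A$1$2) (A$2$1) (A$2$2)"
    by (simp add: vec_eq_iff forall_2)
qed

lemma mat2_mult [simp]:
  "mat2 a b c d ** mat2 e f g h = mat2 (a*e + b*g) (a*f + b*h) (c*e + d*g) (c*f + d*h)"
  by (simp add: vec_eq_iff forall_2 matrix_matrix_mult_def sum_2)

lemma mat2_arith:
  "mat2 a b c d + mat2 e f g h = mat2 (a + e) (b + f) (c + g) (d + h)"
  "mat2 a b c d - mat2 e f g h = mat2 (a - e) (b - f) (c - g) (d - h)"
  "- mat2 a b c d = mat2 (- a) (- b) (- c) (- d)"
  "r *\<^sub>R mat2 a b c d = mat2 (r * a) (r * b) (r * c) (r * d)"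
  by (simp_all add: vec_eq_iff forall_2)

lemma det_mat2 [simp]: "det (mat2 a b c d) = a * d - b * c"
  by (simp add: det_2)

lemma trace_mat2 [simp]: "trace (mat2 a b c d) = a + d"
  by (simp add: trace_def sum_2)

lemma mat1_eq: "mat 1 = mat2 1 0 0 1"
  by (simp add: vec_eq_iff forall_2 mat_def)

lemma rot_eq: "rot \<theta> = mat2 (cos \<theta>) (- sin \<theta>) (sin \<theta>) (cos \<theta>)"
  by (simp add: rot_def mat2_def)

lemma hyp_eq: "hyp l = mat2 (exp l) 0 0 (exp (- l))"
  by (simp add: hyp_def mat2_def)

lemma norm_mat2: "(norm (mat2 a b c d))\<^sup>2 = a\<^sup>2 + b\<^sup>2 + c\<^sup>2 + d\<^sup>2"
  unfolding power2_norm_eq_inner by (simp add: inner_vec_def sum_2 power2_eq_square)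

lemma norm_mat1: "norm (mat 1 :: real^2^2) = sqrt 2"
proof -
  have "(norm (mat 1 :: real^2^2))\<^sup>2 = 2"
    by (simp add: mat1_eq norm_mat2)
  then show ?thesis
    by (metis norm_ge_zero real_sqrt_unique)
qed

lemma norm_rot: "norm (rot \<theta>) = sqrt 2"
proof -
  have "(norm (rot \<theta>))\<^sup>2 = 2 * ((cos \<theta>)\<^sup>2 + (sin \<theta>)\<^sup>2)"
    unfolding rot_eq norm_mat2 by simp
  then have "(norm (rot \<theta>))\<^sup>2 = 2"
    by simp
  then show ?thesis
    by (metis norm_ge_zero real_sqrt_unique)
qed

text \<open>
  The norm of \<open>real^2^2\<close> is the Frobenius norm, and the bound is the Cauchy-Schwarz inequality for each
  entry of the product.
\<close>

lemma norm_matrix_mult_le: "norm (A ** B) \<le> norm A * norm B" for A B :: "real^2^2"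
proof (cases A rule: mat2_cases; cases B rule: mat2_cases)
  fix a b c d e f g h
  assume A: "A = mat2 a b c d" and B: "B = mat2 e f g h"
  have cs: "(x * u + y * v)\<^sup>2 \<le> (x\<^sup>2 + y\<^sup>2) * (u\<^sup>2 + v\<^sup>2)" for x y u v :: real
  proof -
    have "(x\<^sup>2 + y\<^sup>2) * (u\<^sup>2 + v\<^sup>2) - (x * u + y * v)\<^sup>2 = (x * v - y * u)\<^sup>2"
      by (simp add: power2_eq_square algebra_simps)
    then show ?thesis by (smt (verit) zero_le_power2)
  qed
  have "(norm (A ** B))\<^sup>2 \<le> (a\<^sup>2+b\<^sup>2)*(e\<^sup>2+g\<^sup>2) + (a\<^sup>2+b\<^sup>2)*(f\<^sup>2+h\<^sup>2)
      + (c\<^sup>2+d\<^sup>2)*(e\<^sup>2+g\<^sup>2) + (c\<^sup>2+d\<^sup>2)*(f\<^sup>2+h\<^sup>2)"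
    unfolding A B mat2_mult norm_mat2 by (intro add_mono cs)
  also have "\<dots> = (norm A * norm B)\<^sup>2"
    unfolding A B power_mult_distrib norm_mat2 by (simp add: algebra_simps)
  finally show ?thesis
    by (rule power2_le_imp_le) simp
qed

lemma norm_matrix_mult_le':
  "norm A \<le> a \<Longrightarrow> norm B \<le> b \<Longrightarrow> norm (A ** B) \<le> a * (b::real)" for A B :: "real^2^2"
  by (meson mult_mono norm_ge_zero norm_matrix_mult_le order_trans)

lemma bounded_bilinear_matrix_mult: "bounded_bilinear ((**) :: real^2^2 \<Rightarrow> real^2^2 \<Rightarrow> real^2^2)"
proof
  show "\<exists>K. \<forall>a b. norm (a ** b :: real^2^2) \<le> norm (a :: real^2^2) * norm (b :: real^2^2) * K"
    using norm_matrix_mult_le by (metis mult.right_neutral)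
qed (simp_all add: matrix_matrix_mult_def vec_eq_iff sum_2 algebra_simps)

lemmas matrix_mult_diff_left = bounded_bilinear.diff_left[OF bounded_bilinear_matrix_mult]
lemmas matrix_mult_diff_right = bounded_bilinear.diff_right[OF bounded_bilinear_matrix_mult]
lemmas continuous_on_matrix_mult =
  bounded_bilinear.continuous_on[OF bounded_bilinear_matrix_mult]

text \<open>
  On \<open>SL2\<close> this is the inverse. Having it as a linear isometry of the space of all matrices shows at
  once that inversion preserves the norm.
\<close>

definition adj2 :: "real^2^2 \<Rightarrow> real^2^2" where
  "adj2 A = mat2 (A$2$2) (- (A$1$2)) (- (A$2$1)) (A$1$1)"

lemma adj2_mat2 [simp]: "adj2 (mat2 a b c d) = mat2 d (- b) (- c) a"
  by (simp add: adj2_def)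

lemma det_adj2 [simp]: "det (adj2 A) = det A"
  by (cases A rule: mat2_cases) simp

lemma norm_adj2 [simp]: "norm (adj2 A) = norm A"
proof (cases A rule: mat2_cases)
  case (mat2 a b c d)
  then have "(norm (adj2 A))\<^sup>2 = (norm A)\<^sup>2"
    by (simp add: norm_mat2)
  then show ?thesis by simp
qed

lemma adj2_mult:
  assumes "det A = 1"
  shows "A ** adj2 A = mat 1" "adj2 A ** A = mat 1"
  using assms by (cases A rule: mat2_cases; simp add: mat1_eq algebra_simps)+

lemma inv_SL2: "det A = 1 \<Longrightarrow> inv\<^bsub>SL2\<^esub> A = adj2 A"
  by (rule group.inv_equality[OF group_SL2]) (simp_all add: adj2_mult)

lemma matrix_mult_cancel_left: 
  assumes "det P = 1" "P ** X = P ** Y" shows "X = (Y :: real^2^2)"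
  by (metis adj2_mult(2) assms matrix_mul_assoc matrix_mul_lid)

lemma adj2_rot: "adj2 (rot \<theta>) = rot (- \<theta>)"
  by (simp add: rot_eq)

lemma adj2_hyp: "adj2 (hyp l) = hyp (- l)"
  by (simp add: hyp_eq)

lemma rot_mult: "rot a ** rot b = rot (a + b)"
  by (simp add: rot_eq cos_add sin_add algebra_simps)

lemma hyp_mult: "hyp a ** hyp b = hyp (a + b)"
  by (simp add: hyp_eq exp_add [symmetric] algebra_simps)

lemma rot_0: "rot 0 = mat 1" and hyp_0: "hyp 0 = mat 1"
  by (simp_all add: rot_eq hyp_eq mat1_eq)


section \<open>Cartan decomposition and paths in SL2\<close>

lemma polar_coordinates:
  obtains r \<phi> :: real where "r \<ge> 0" "x = r * cos \<phi>" "y = r * sin \<phi>"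
proof
  let ?z = "Complex x y"
  show "x = cmod ?z * cos (Arg ?z)" "y = cmod ?z * sin (Arg ?z)"
    by (metis Re_rcis complex.sel(1) rcis_cmod_Arg, metis Im_rcis complex.sel(2) rcis_cmod_Arg)
qed simp

text \<open>
  Identify the plane with the complex numbers and write \<open>A\<close> as \<open>z \<mapsto> u z + v cnj z\<close>, so that
  \<open>\<bar>u\<bar>\<^sup>2 - \<bar>v\<bar>\<^sup>2 = det A = 1\<close>. Rotations on the left and on the right multiply \<open>u\<close> and \<open>v\<close> by independent
  phases. When both \<open>u = p\<close> and \<open>v = r\<close> are nonnegative reals, the matrix is diagonal with entries
  \<open>p + r\<close> and \<open>p - r\<close>.
\<close>

lemma Cartan_decomposition:
  assumes "det A = 1"
  obtains \<alpha> t \<beta> where "t \<ge> 0" "A = rot \<alpha> ** hyp t ** rot \<beta>"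
proof (cases A rule: mat2_cases)
  case (mat2 a b c d)
  obtain p \<phi> where p: "p \<ge> 0" "(a + d) / 2 = p * cos \<phi>" "(c - b) / 2 = p * sin \<phi>"
    using polar_coordinates by metis
  obtain r \<psi> where r: "r \<ge> 0" "(a - d) / 2 = r * cos \<psi>" "(b + c) / 2 = r * sin \<psi>"
    using polar_coordinates by metis
  have abcd: "a = p * cos \<phi> + r * cos \<psi>" "b = r * sin \<psi> - p * sin \<phi>"
    "c = p * sin \<phi> + r * sin \<psi>" "d = p * cos \<phi> - r * cos \<psi>"
    using p r by argo+
  have "1 = a * d - b * c"
    using assms mat2 by simp
  also have "\<dots> = p\<^sup>2 * ((cos \<phi>)\<^sup>2 + (sin \<phi>)\<^sup>2) - r\<^sup>2 * ((cos \<psi>)\<^sup>2 + (sin \<psi>)\<^sup>2)"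
    unfolding abcd by algebra
  also have "\<dots> = (p + r) * (p - r)"
    unfolding sin_cos_squared_add2 by (simp add: power2_eq_square algebra_simps)
  finally have pr: "(p + r) * (p - r) = 1" ..
  have "p + r > 0"
    using pr p r by (metis add_nonneg_nonneg less_eq_real_def mult_zero_left zero_neq_one)
  have "p + r \<ge> 1"
  proof (rule ccontr)
    assume "\<not> p + r \<ge> 1"
    then have "(p + r) * (p + r) < 1"
      using \<open>p + r > 0\<close> by (smt (verit) mult_less_cancel_left2)
    moreover have "(p + r) * (p - r) \<le> (p + r) * (p + r)"
      using \<open>p + r > 0\<close> r by (intro mult_left_mono) auto
    ultimately show False using pr by linarith
  qed
  define t where "t = ln (p + r)"
  have t: "exp t = p + r" "exp (- t) = p - r"
    using \<open>p + r > 0\<close> pr by (auto simp: t_def exp_minus field_simps)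
  define \<alpha> \<beta> where "\<alpha> = (\<phi> + \<psi>) / 2" and "\<beta> = (\<phi> - \<psi>) / 2"
  have \<phi>: "\<phi> = \<alpha> + \<beta>" and \<psi>: "\<psi> = \<alpha> - \<beta>"
    by (auto simp: \<alpha>_def \<beta>_def field_simps)
  have "A = rot \<alpha> ** hyp t ** rot \<beta>"
    unfolding mat2 abcd \<phi> \<psi> rot_eq hyp_eq t
    by (simp add: cos_add sin_add cos_diff sin_diff algebra_simps)
  moreover have "t \<ge> 0"
    using \<open>p + r \<ge> 1\<close> by (simp add: t_def)
  ultimately show ?thesis using that by blast
qed

lemma C1_differentiable_on_matrix_mult:
  fixes f g :: "real \<Rightarrow> real^2^2"
  assumes "f C1_differentiable_on S" "g C1_differentiable_on S"
  shows "(\<lambda>t. f t ** g t) C1_differentiable_on S"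
proof -
  obtain D E where D: "\<And>t. t \<in> S \<Longrightarrow> (f has_vector_derivative D t) (at t)" "continuous_on S D"
    and E: "\<And>t. t \<in> S \<Longrightarrow> (g has_vector_derivative E t) (at t)" "continuous_on S E"
    using assms unfolding C1_differentiable_on_def by blast
  have "continuous_on S f" "continuous_on S g"
    using D(1) E(1) by (meson continuous_at_imp_continuous_on has_vector_derivative_continuous)+
  then have "continuous_on S (\<lambda>t. f t ** E t + D t ** g t)"
    using D(2) E(2) by (intro continuous_intros continuous_on_matrix_mult)
  moreover have "\<forall>t\<in>S. ((\<lambda>t. f t ** g t) has_vector_derivative f t ** E t + D t ** g t) (at t)"
    using D(1) E(1) by (blast intro: bounded_bilinear.has_vector_derivative[OF bounded_bilinear_matrix_mult])
  ultimately show ?thesis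
    unfolding C1_differentiable_on_def
    by (intro exI[of _ "\<lambda>t. f t ** E t + D t ** g t"] conjI)
qed

lemma mat2_expand:
  "mat2 a b c d = a *\<^sub>R mat2 1 0 0 0 + b *\<^sub>R mat2 0 1 0 0 + c *\<^sub>R mat2 0 0 1 0 + d *\<^sub>R mat2 0 0 0 1"
  unfolding mat2_arith by (simp only: mat2_eq_iff) simp

lemma continuous_on_mat2:
  assumes "continuous_on S a" "continuous_on S b" "continuous_on S c" "continuous_on S d"
  shows "continuous_on S (\<lambda>t. mat2 (a t) (b t) (c t) (d t))"
  unfolding mat2_expand[of "a t" "b t" "c t" "d t" for t]
  by (intro continuous_on_add continuous_on_scaleR continuous_on_const assms)

lemma C1_differentiable_on_mat2:
  assumes "\<And>t. (a has_real_derivative a' t) (at t)" "\<And>t. (b has_real_derivative b' t) (at t)"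
    "\<And>t. (c has_real_derivative c' t) (at t)" "\<And>t. (d has_real_derivative d' t) (at t)"
    and cont: "continuous_on S a'" "continuous_on S b'" "continuous_on S c'" "continuous_on S d'"
  shows "(\<lambda>t. mat2 (a t) (b t) (c t) (d t)) C1_differentiable_on S"
proof -
  have scale: "((\<lambda>t. f t *\<^sub>R C) has_vector_derivative f' *\<^sub>R C) (at t)"
    if "(f has_real_derivative f') (at t)" for f f' t and C :: "real^2^2"
    using has_vector_derivative_scaleR[OF that has_vector_derivative_const[of C]] by simp
  have der: "((\<lambda>t. mat2 (a t) (b t) (c t) (d t)) has_vector_derivative
      mat2 (a' t) (b' t) (c' t) (d' t)) (at t)" for t
    unfolding mat2_expand[of "a t" "b t" "c t" "d t" for t]
      mat2_expand[of "a' t" "b' t" "c' t" "d' t"]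
    by (intro has_vector_derivative_add scale assms)
  show ?thesis
    unfolding C1_differentiable_on_def
    by (intro exI[of _ "\<lambda>t. mat2 (a' t) (b' t) (c' t) (d' t)"] conjI ballI der
        continuous_on_mat2 cont)
qed

text \<open>
  Scaling the three parameters of the Cartan decomposition by the time gives a smooth path. Without
  such a path, the infimum that defines \<^const>\<open>SL2_dist\<close> could be taken over the empty set, where its
  value says nothing.
\<close>

lemma SL2_C1_path_connected:
  assumes "det A = 1"
  obtains \<gamma> where "\<gamma> C1_differentiable_on {0..1}" "\<gamma> ` {0..1} \<subseteq> carrier SL2"
    "\<gamma> 0 = mat 1" "\<gamma> 1 = A"
proof -
  obtain \<alpha> t \<beta> where A: "A = rot \<alpha> ** hyp t ** rot \<beta>"
    using Cartan_decomposition[OF assms] by metis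
  let ?\<gamma> = "\<lambda>u. rot (\<alpha> * u) ** hyp (t * u) ** rot (\<beta> * u)"
  have rot: "(\<lambda>u. rot (x * u)) C1_differentiable_on {0..1}" for x
    unfolding rot_eq
    by (rule C1_differentiable_on_mat2[where a' = "\<lambda>u. - (x * sin (x * u))" and
          b' = "\<lambda>u. - (x * cos (x * u))" and c' = "\<lambda>u. x * cos (x * u)" and
          d' = "\<lambda>u. - (x * sin (x * u))"])
      (auto intro!: derivative_eq_intros continuous_intros)
  have hyp: "(\<lambda>u. hyp (x * u)) C1_differentiable_on {0..1}" for x
    unfolding hyp_eq
    by (rule C1_differentiable_on_mat2[where a' = "\<lambda>u. x * exp (x * u)" and
          b' = "\<lambda>_. 0" and c' = "\<lambda>_. 0" and d' = "\<lambda>u. - (x * exp (- (x * u)))"])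
      (auto intro!: derivative_eq_intros continuous_intros)
  show ?thesis
  proof
    show "?\<gamma> C1_differentiable_on {0..1}"
      by (intro C1_differentiable_on_matrix_mult rot hyp)
    show "?\<gamma> ` {0..1} \<subseteq> carrier SL2"
      by (auto simp: det_mul)
  qed (simp_all add: A rot_0 hyp_0)
qed
 
section \<open>The metric near the identity\<close>

lemma inner_product_on_sl2_bounded_bilinear: "inner_product_on_sl2 Q \<Longrightarrow> bounded_bilinear Q"
  by (simp add: inner_product_on_sl2_def bilinear_conv_bounded_bilinear)

lemma inner_product_on_sl2_lower_bound:
  assumes "inner_product_on_sl2 Q"
  obtains m where "m > 0" "\<And>X. X \<in> sl2 \<Longrightarrow> m * norm X \<le> sqrt (Q X X)"
proof -
  note bil = inner_product_on_sl2_bounded_bilinear[OF assms]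
  have pos: "\<And>X. X \<in> sl2 \<Longrightarrow> X \<noteq> 0 \<Longrightarrow> Q X X > 0"
    using assms by (simp add: inner_product_on_sl2_def)
  let ?S = "sl2 \<inter> sphere 0 1"
  have "closed sl2"
    unfolding sl2_def trace_def by (simp add: sum_2) (intro closed_Collect_eq continuous_intros)
  then have "compact ?S"
    by (simp add: closed_Int_compact)
  moreover have "norm (mat2 0 1 0 0) = 1"
    using norm_mat2[of 0 1 0 0] by (simp add: power2_eq_1_iff) (smt (verit) norm_ge_zero)
  then have "mat2 0 1 0 0 \<in> ?S"
    by (simp add: sl2_def)
  moreover have "continuous_on ?S (\<lambda>X. Q X X)"
    by (intro bounded_bilinear.continuous_on[OF bil] continuous_intros)
  ultimately obtain X0 where X0: "X0 \<in> ?S" "\<And>X. X \<in> ?S \<Longrightarrow> Q X0 X0 \<le> Q X X"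
    using continuous_attains_inf[of ?S "\<lambda>X. Q X X"] by blast
  define m where "m = sqrt (Q X0 X0)"
  have "X0 \<noteq> 0" using X0 by auto
  then have "m > 0"
    using pos X0 by (simp add: m_def)
  moreover have "m * norm X \<le> sqrt (Q X X)" if X: "X \<in> sl2" for X
  proof (cases "X = 0")
    case True
    then show ?thesis by (simp add: bounded_bilinear.zero_left[OF bil])
  next
    case False
    define Y where "Y = X /\<^sub>R norm X"
    have XY: "X = norm X *\<^sub>R Y" using False by (simp add: Y_def)
    have "trace Y = trace X / norm X"
      by (cases X rule: mat2_cases) (simp add: Y_def mat2_arith add_divide_distrib divide_inverse_commute distrib_left)
    then have "Y \<in> ?S" using False X by (simp add: Y_def sl2_def)
    then have "m \<le> sqrt (Q Y Y)"
      using X0 by (simp add: m_def)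
    then have "norm X * m \<le> norm X * sqrt (Q Y Y)"
      by (intro mult_left_mono) auto
    also have "\<dots> = sqrt ((norm X)\<^sup>2 * Q Y Y)"
      by (simp add: real_sqrt_mult)
    also have "(norm X)\<^sup>2 * Q Y Y = Q (norm X *\<^sub>R Y) (norm X *\<^sub>R Y)"
      by (simp add: bounded_bilinear.scaleR_left[OF bil] bounded_bilinear.scaleR_right[OF bil]
          power2_eq_square)
    also have "\<dots> = Q X X" using XY by metis
    finally show ?thesis by (simp add: mult.commute)
  qed
  ultimately show ?thesis using that by blast
qed

text \<open>
  The derivative of the determinant along the path is the trace in question. At the end points only the
  one-sided derivative of \<open>det (\<gamma> t)\<close> is known to vanish, but it determines the two-sided one.
\<close>

lemma SL2_path_tangent:
  assumes der: "(\<gamma> has_vector_derivative D) (at t)" and t: "t \<in> {0..1}"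
    and \<gamma>: "\<gamma> ` {0..1} \<subseteq> carrier SL2"
  shows "adj2 (\<gamma> t) ** D \<in> sl2"
proof -
  have entry: "((\<lambda>s. \<gamma> s $ i $ j) has_vector_derivative D $ i $ j) (at t within {0..1})" for i j
    using bounded_linear.has_vector_derivative[OF bounded_linear_vec_nth
        bounded_linear.has_vector_derivative[OF bounded_linear_vec_nth der]]
    by (rule has_vector_derivative_at_within)
  have "((\<lambda>s. det (\<gamma> s)) has_vector_derivative trace (adj2 (\<gamma> t) ** D)) (at t within {0..1})"
    unfolding det_2
    using entry[of 1 1] entry[of 1 2] entry[of 2 1] entry[of 2 2]
    by (auto intro!: derivative_eq_intros
        simp: trace_def sum_2 adj2_def matrix_matrix_mult_def)
  moreover have "((\<lambda>s. det (\<gamma> s)) has_vector_derivative 0) (at t within {0..1})"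
    by (rule has_vector_derivative_transform[of t _ _ "\<lambda>_. 1"]) (use \<gamma> t in \<open>auto simp: image_subset_iff\<close>)
  ultimately have "trace (adj2 (\<gamma> t) ** D) = 0"
    using vector_derivative_unique_within_closed_interval[of 0 1 t] t by simp
  then show ?thesis by (simp add: sl2_def)
qed

text \<open>
  The velocity is \<open>\<gamma> t ** V t\<close> with \<open>V t\<close> in the Lie algebra, hence bounded by \<open>norm (\<gamma> t) / m\<close> times the
  speed. With \<open>M\<close> the largest value of \<open>norm (\<gamma> t - mat 1)\<close>, this gives \<open>M \<le> (2 + M) / m\<close> times the
  length. A length below \<open>m / 4\<close> lets the term in \<open>M\<close> on the right be absorbed on the left.
\<close>

lemma path_displacement_le:
  assumes m: "m > 0" "\<And>X. X \<in> sl2 \<Longrightarrow> m * norm X \<le> sqrt (Q X X)"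
    and bil: "bounded_bilinear Q"
    and \<gamma>: "\<gamma> C1_differentiable_on {0..1}" "\<gamma> ` {0..1} \<subseteq> carrier SL2" "\<gamma> 0 = mat 1"
    and len: "path_length Q \<gamma> \<le> m / 4"
  shows "norm (\<gamma> 1 - mat 1) \<le> 4 / m * path_length Q \<gamma>"
proof -
  obtain D where D: "\<And>t. t \<in> {0..1} \<Longrightarrow> (\<gamma> has_vector_derivative D t) (at t)"
      and cD: "continuous_on {0..1} D"
    using \<gamma>(1) unfolding C1_differentiable_on_def by blast
  have c\<gamma>: "continuous_on {0..1} \<gamma>"
    using D by (meson continuous_at_imp_continuous_on has_vector_derivative_continuous)
  have det: "det (\<gamma> t) = 1" if "t \<in> {0..1}" for t
    using \<gamma>(2) that by (simp add: image_subset_iff)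
  define V where "V t = adj2 (\<gamma> t) ** D t" for t
  define f where "f t = sqrt (Q (V t) (V t))" for t
  have V: "V t \<in> sl2" if "t \<in> {0..1}" for t
    using SL2_path_tangent[OF D] that \<gamma>(2) by (simp add: V_def)
  have "continuous_on {0..1} (\<lambda>t. adj2 (\<gamma> t))"
    unfolding adj2_def by (intro continuous_on_mat2 continuous_intros c\<gamma>)
  then have "continuous_on {0..1} V"
    unfolding V_def using cD by (intro continuous_on_matrix_mult)
  then have cf: "continuous_on {0..1} f"
    unfolding f_def by (intro continuous_intros bounded_bilinear.continuous_on[OF bil])
  have f0: "f t \<ge> 0" if "t \<in> {0..1}" for t
    using m V[OF that] unfolding f_def by (smt (verit) mult_nonneg_nonneg norm_ge_zero)
  have L: "path_length Q \<gamma> = integral {0..1} f"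
    unfolding path_length_def Let_def
  proof (rule integral_cong)
    fix t :: real assume t: "t \<in> {0..1}"
    show "sqrt (Q (inv\<^bsub>SL2\<^esub> \<gamma> t ** vector_derivative \<gamma> (at t))
        (inv\<^bsub>SL2\<^esub> \<gamma> t ** vector_derivative \<gamma> (at t))) = f t"
      unfolding f_def V_def inv_SL2[OF det[OF t]] vector_derivative_at[OF D[OF t]] ..
  qed
  have "continuous_on {0..1} (\<lambda>t. norm (\<gamma> t - mat 1))"
    by (intro continuous_intros c\<gamma>)
  from continuous_attains_sup[OF _ _ this] obtain u where u: "u \<in> {0..1}"
    and umax: "\<And>t. t \<in> {0..1} \<Longrightarrow> norm (\<gamma> t - mat 1) \<le> norm (\<gamma> u - mat 1)"
    by auto
  define M where "M = norm (\<gamma> u - mat 1)"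
  have sub: "{0..u} \<subseteq> {0..1}" using u by auto
  have Db: "norm (D t) \<le> (2 + M) / m * f t" if t: "t \<in> {0..1}" for t
  proof -
    have "norm (\<gamma> t) \<le> sqrt 2 + M"
      using umax[OF t] norm_triangle_sub[of "\<gamma> t" "mat 1"] by (simp add: M_def norm_mat1)
    also have "sqrt 2 \<le> (2::real)" by (rule real_le_lsqrt) auto
    finally have 1: "norm (\<gamma> t) \<le> 2 + M" by simp
    have 2: "norm (V t) \<le> f t / m"
      using m(2)[OF V[OF t]] m(1) by (simp add: f_def field_simps)
    have "D t = \<gamma> t ** V t"
      using adj2_mult(1)[OF det[OF t]] by (simp add: V_def matrix_mul_assoc)
    then show ?thesis
      using norm_matrix_mult_le'[OF 1 2] by simp
  qed
  have "(D has_integral \<gamma> u - \<gamma> 0) {0..u}"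
    using u D by (intro fundamental_theorem_of_calculus) (auto intro: has_vector_derivative_at_within)
  then have "M = norm (integral {0..u} D)"
    by (simp add: M_def \<gamma>(3) integral_unique)
  also have "\<dots> \<le> integral {0..u} (\<lambda>t. (2 + M) / m * f t)"
    using sub cD cf Db
    by (intro integral_norm_bound_integral integrable_continuous_real continuous_intros)
       (auto intro: continuous_on_subset)
  also have "\<dots> = (2 + M) / m * integral {0..u} f"
    by simp
  also have "integral {0..u} f \<le> path_length Q \<gamma>"
    unfolding L using sub f0 cf
    by (intro integral_subset_le integrable_continuous_real) (auto intro: continuous_on_subset)
  then have "(2 + M) / m * integral {0..u} f \<le> (2 + M) / m * path_length Q \<gamma>"
    using m(1) by (intro mult_left_mono) (auto simp: M_def)
  finally have "M \<le> 2 / m * path_length Q \<gamma> + M * (path_length Q \<gamma> / m)"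
    by (simp add: add_divide_distrib algebra_simps)
  also have "M * (path_length Q \<gamma> / m) \<le> M * (1 / 4)"
    using len m(1) by (intro mult_left_mono) (auto simp: M_def field_simps)
  finally have M: "3 * M \<le> 8 / m * path_length Q \<gamma>"
    by (simp add: field_simps)
  have "path_length Q \<gamma> \<ge> 0"
    unfolding L using cf f0 by (intro integral_nonneg integrable_continuous_real) auto
  then have "8 / m * path_length Q \<gamma> \<le> 12 / m * path_length Q \<gamma>"
    using m(1) by (intro mult_right_mono divide_right_mono) auto
  then have "M \<le> 4 / m * path_length Q \<gamma>"
    using M by (simp add: field_simps)
  then show ?thesis
    using umax[of 1] by (simp add: M_def)
qed

lemma SL2_ball_norm_bound:
  assumes Q: "inner_product_on_sl2 Q"
  obtains r0 C where "r0 > 0" "C > 0"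
    "\<And>r h. r \<le> r0 \<Longrightarrow> h \<in> SL2_ball Q (mat 1) r \<Longrightarrow> norm (h - mat 1) \<le> C * r"
proof -
  note bil = inner_product_on_sl2_bounded_bilinear[OF Q]
  obtain m where m: "m > 0" "\<And>X. X \<in> sl2 \<Longrightarrow> m * norm X \<le> sqrt (Q X X)"
    using inner_product_on_sl2_lower_bound[OF Q] by blast
  have "norm (h - mat 1) \<le> 4 / m * r" if r: "r \<le> m / 4" and h: "h \<in> SL2_ball Q (mat 1) r" for r h
  proof -
    let ?P = "{path_length Q \<gamma> | \<gamma>. \<gamma> C1_differentiable_on {0..1} \<and> \<gamma> ` {0..1} \<subseteq> carrier SL2
        \<and> \<gamma> 0 = mat 1 \<and> \<gamma> 1 = h}"
    have "det h = 1" and "Inf ?P < r"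
      using h by (auto simp: SL2_ball_def SL2_dist_def)
    moreover have "?P \<noteq> {}"
      using SL2_C1_path_connected[OF \<open>det h = 1\<close>] by blast
    ultimately obtain x where "x \<in> ?P" "x < r"
      by (meson cInf_greatest not_le)
    then obtain \<gamma> where \<gamma>: "\<gamma> C1_differentiable_on {0..1}" "\<gamma> ` {0..1} \<subseteq> carrier SL2"
        "\<gamma> 0 = mat 1" "\<gamma> 1 = h" and len: "path_length Q \<gamma> < r"
      by blast
    have "norm (h - mat 1) \<le> 4 / m * path_length Q \<gamma>"
      using path_displacement_le[OF m bil \<gamma>(1-3)] len r \<gamma>(4) by simp
    also have "\<dots> \<le> 4 / m * r"
      using m(1) len by (intro mult_left_mono) auto
    finally show ?thesis .
  qed
  then show ?thesis
    using that[of "m / 4" "4 / m"] m(1) by simp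
qed

text \<open>
  The constant path has length 0. That no closed path at the identity has negative length follows from
  the displacement bound, applied to the supposed negative length.
\<close>

lemma mat1_in_SL2_ball:
  assumes Q: "inner_product_on_sl2 Q" and r: "r > 0"
  shows "mat 1 \<in> SL2_ball Q (mat 1) r"
proof -
  note bil = inner_product_on_sl2_bounded_bilinear[OF Q]
  obtain m where m: "m > 0" "\<And>X. X \<in> sl2 \<Longrightarrow> m * norm X \<le> sqrt (Q X X)"
    using inner_product_on_sl2_lower_bound[OF Q] by blast
  let ?P = "{path_length Q \<gamma> | \<gamma>. \<gamma> C1_differentiable_on {0..1} \<and> \<gamma> ` {0..1} \<subseteq> carrier SL2
      \<and> \<gamma> 0 = mat 1 \<and> \<gamma> 1 = mat 1}"
  have "path_length Q \<gamma> \<ge> 0" 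
    if "\<gamma> C1_differentiable_on {0..1}" "\<gamma> ` {0..1} \<subseteq> carrier SL2" "\<gamma> 0 = mat 1" for \<gamma>
  proof (rule ccontr)
    assume neg: "\<not> path_length Q \<gamma> \<ge> 0"
    then have "norm (\<gamma> 1 - mat 1) \<le> 4 / m * path_length Q \<gamma>"
      using m(1) by (intro path_displacement_le[OF m bil that]) auto
    also have "\<dots> < 0"
      using neg m(1) by (intro mult_pos_neg) auto
    finally show False by simp
  qed
  then have "bdd_below ?P"
    by (intro bdd_belowI[of _ 0]) auto
  moreover have "path_length Q (\<lambda>_. mat 1) = 0"
    by (simp add: path_length_def bounded_bilinear.zero_left[OF bil])
  then have "0 \<in> ?P"
    by (force intro!: exI[of _ "\<lambda>_. mat 1"])
  ultimately have "Inf ?P \<le> 0"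
    by (rule cInf_lower[rotated])
  then show ?thesis
    using r by (simp add: SL2_ball_def SL2_dist_def)
qed


section \<open>Density of Delta\<close>

lemma norm_rot_mult: "norm (rot \<alpha> ** A) = norm A" for A :: "real^2^2"
proof (cases A rule: mat2_cases)
  case (mat2 a b c d)
  have "(norm (rot \<alpha> ** A))\<^sup>2 = ((cos \<alpha>)\<^sup>2 + (sin \<alpha>)\<^sup>2) * (a\<^sup>2 + b\<^sup>2 + c\<^sup>2 + d\<^sup>2)"
    unfolding mat2 rot_eq mat2_mult norm_mat2 by algebra
  then have "(norm (rot \<alpha> ** A))\<^sup>2 = (norm A)\<^sup>2"
    by (simp add: mat2 norm_mat2)
  then show ?thesis by simp
qed

lemma norm_mult_rot: "norm (A ** rot \<alpha>) = norm A" for A :: "real^2^2"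
proof (cases A rule: mat2_cases)
  case (mat2 a b c d)
  have "(norm (A ** rot \<alpha>))\<^sup>2 = ((cos \<alpha>)\<^sup>2 + (sin \<alpha>)\<^sup>2) * (a\<^sup>2 + b\<^sup>2 + c\<^sup>2 + d\<^sup>2)"
    unfolding mat2 rot_eq mat2_mult norm_mat2 by algebra
  then have "(norm (A ** rot \<alpha>))\<^sup>2 = (norm A)\<^sup>2"
    by (simp add: mat2 norm_mat2)
  then show ?thesis by simp
qed

lemma norm_hyp: "(norm (hyp t))\<^sup>2 = 2 * cosh (2 * t)"
  unfolding hyp_eq norm_mat2 by (simp add: cosh_field_def power2_eq_square exp_add [symmetric])

text \<open>
  By the Cartan decomposition it is enough to find all \<open>hyp t\<close>, and a matrix of determinant 1 lies in the
  double coset of \<open>hyp t\<close> under the rotations as soon as it has the same norm. The norm of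
  \<open>hyp l ** rot \<beta> ** hyp l\<close> runs through all the values up to that of \<open>hyp (2 * l)\<close>, which yields \<open>hyp t\<close>
  for \<open>t \<le> 2 * l\<close>; powers of these give the others.
\<close>

lemma SL2_generated_by_rotations_and_hyp:
  assumes mult: "\<And>A B. A \<in> H \<Longrightarrow> B \<in> H \<Longrightarrow> A ** B \<in> H"
    and rot: "\<And>\<alpha>. rot \<alpha> \<in> H" and hyp: "hyp l \<in> H" "l > 0"
    and A: "det A = 1"
  shows "A \<in> H"
proof -
  have small: "hyp t \<in> H" if t: "0 \<le> t" "t \<le> 2 * l" for t
  proof -
    \<comment> \<open>The value of \<open>(cos \<beta>)\<^sup>2\<close> for which the squared norm of \<open>X\<close> below is \<open>2 * cosh (2 * t)\<close>.\<close>
    define c where "c = (cosh (2 * t) - 1) / (cosh (4 * l) - 1)"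
    have l: "cosh (4 * l) > 1"
      using hyp(2) cosh_real_strict_mono[of 0 "4 * l"] by simp
    have "cosh (2 * t) \<le> cosh (4 * l)"
      using t by (subst cosh_real_nonneg_le_iff) auto
    then have c: "0 \<le> c" "c \<le> 1"
      using l cosh_real_ge_1[of "2 * t"] by (auto simp: c_def)
    define \<beta> where "\<beta> = arccos (sqrt c)"
    have "cos \<beta> = sqrt c"
      unfolding \<beta>_def using c by (intro cos_arccos) (auto intro: order_trans[of _ 0])
    then have cos: "(cos \<beta>)\<^sup>2 = c" using c by simp
    then have sin: "(sin \<beta>)\<^sup>2 = 1 - c" by (simp add: sin_squared_eq)
    define X where "X = hyp l ** rot \<beta> ** hyp l"
    have X: "X \<in> H" "det X = 1"
      by (simp_all add: X_def mult rot hyp det_mul)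
    obtain \<alpha> t' \<alpha>' where t': "t' \<ge> 0" and X_eq: "X = rot \<alpha> ** hyp t' ** rot \<alpha>'"
      using Cartan_decomposition[OF X(2)] by metis
    have "2 * cosh (2 * t') = (norm X)\<^sup>2"
      by (simp add: X_eq norm_mult_rot norm_rot_mult norm_hyp)
    also have "X = mat2 (exp (2 * l) * cos \<beta>) (- sin \<beta>) (sin \<beta>) (exp (- 2 * l) * cos \<beta>)"
      by (simp add: X_def hyp_eq rot_eq exp_add [symmetric] algebra_simps)
    also have "(norm \<dots>)\<^sup>2 = (cos \<beta>)\<^sup>2 * ((exp (2 * l))\<^sup>2 + (exp (- 2 * l))\<^sup>2) + 2 * (sin \<beta>)\<^sup>2"
      unfolding norm_mat2 by algebra
    also have "(exp (2 * l))\<^sup>2 + (exp (- 2 * l))\<^sup>2 = 2 * cosh (4 * l)"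
      by (simp add: cosh_field_def power2_eq_square exp_add [symmetric])
    also have "(cos \<beta>)\<^sup>2 * (2 * cosh (4 * l)) + 2 * (sin \<beta>)\<^sup>2 = 2 * (c * (cosh (4 * l) - 1) + 1)"
      unfolding cos sin by (simp add: algebra_simps)
    also have "\<dots> = 2 * cosh (2 * t)"
      using l by (simp add: c_def del: cosh_real_one_iff)
    finally have "\<not> 2 * t < 2 * t'" "\<not> 2 * t' < 2 * t"
      using t t' cosh_real_nonneg_less_iff[of "2 * t" "2 * t'"] cosh_real_nonneg_less_iff[of "2 * t'" "2 * t"]
      by auto
    then have "t' = t" by simp
    have "rot (- \<alpha>) ** X = hyp t ** rot \<alpha>'"
      by (simp add: X_eq \<open>t' = t\<close> matrix_mul_assoc rot_mult rot_0)
    then have "rot (- \<alpha>) ** X ** rot (- \<alpha>') = hyp t"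
      by (simp add: matrix_mul_assoc [symmetric] rot_mult rot_0)
    then show ?thesis
      using mult rot X(1) by metis
  qed
  have hyp_H: "hyp t \<in> H" if t: "t \<ge> 0" for t
  proof -
    obtain m where m: "real m * (2 * l) > t"
      using hyp(2) ex_less_of_nat_mult[of "2 * l" t] by auto
    then have "m > 0" using t by (cases m) auto
    have "hyp (real k * (t / real m)) \<in> H" for k
    proof (induction k)
      case 0
      show ?case using rot[of 0] by (simp add: hyp_0 rot_0)
    next
      case (Suc k)
      have "hyp (t / real m) \<in> H"
        using \<open>m > 0\<close> m t by (intro small) (auto simp: field_simps)
      then have "hyp (t / real m + real k * (t / real m)) \<in> H"
        using mult[OF _ Suc] unfolding hyp_mult [symmetric] by blast
      moreover have "t / real m + real k * (t / real m) = real (Suc k) * (t / real m)"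
        by (simp add: distrib_right add_divide_distrib)
      ultimately show ?case by metis
    qed
    from this[of m] show ?thesis using \<open>m > 0\<close> by simp
  qed
  obtain \<alpha> t \<beta> where "t \<ge> 0" "A = rot \<alpha> ** hyp t ** rot \<beta>"
    using Cartan_decomposition[OF A] by metis
  then show ?thesis using mult rot hyp_H by simp
qed

lemma rot_add_2pi: "rot (\<alpha> + 2 * pi * of_int k) = rot \<alpha>"
  by (simp add: rot_eq sin_add cos_add sin_int_2pin cos_int_2pin)

text \<open>
  This is Kronecker's theorem on the multiples of an irrational number modulo 1.
\<close>

lemma rot_powers_dense:
  assumes irrational: "\<theta> / (2 * pi) \<notin> \<rat>"
  shows "rot \<alpha> \<in> closure (range (\<lambda>k::nat. rot (of_nat k * \<theta>)))"
  unfolding closure_approachable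
proof (intro allI impI)
  fix e :: real assume "e > 0"
  have "continuous_on UNIV rot"
    unfolding rot_eq [abs_def] by (intro continuous_on_mat2 continuous_intros)
  then obtain d where d: "d > 0" "\<And>x. dist x \<alpha> < d \<Longrightarrow> dist (rot x) (rot \<alpha>) < e"
    using \<open>e > 0\<close> unfolding continuous_on_iff by (metis UNIV_I)
  obtain h k where k: "k > 0"
    "\<bar>of_int k * (\<theta> / (2 * pi)) - of_int h - \<alpha> / (2 * pi)\<bar> < d / (2 * pi)"
    using sequence_of_fractional_parts_is_dense[OF irrational, of "d / (2 * pi)" "\<alpha> / (2 * pi)"] d(1)
    by (metis divide_pos_pos mult_pos_pos pi_gt_zero zero_less_numeral)
  have "of_int k * \<theta> + 2 * pi * of_int (- h) - \<alpha>
      = (2 * pi) * (of_int k * (\<theta> / (2 * pi)) - of_int h - \<alpha> / (2 * pi))"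
    by (simp add: field_simps)
  then have "dist (of_int k * \<theta> + 2 * pi * of_int (- h)) \<alpha> < d"
    using k(2) by (simp only: dist_real_def abs_mult) (simp add: field_simps)
  then have "dist (rot (of_int k * \<theta>)) (rot \<alpha>) < e"
    using d(2) rot_add_2pi by metis
  moreover have "rot (of_int k * \<theta>) = rot (of_nat (nat k) * \<theta>)"
    using k(1) by simp
  ultimately show "\<exists>y\<in>range (\<lambda>k::nat. rot (of_nat k * \<theta>)). dist y (rot \<alpha>) < e"
    by (metis rangeI)
qed

lemma subgroup_Delta_sub: "subgroup (Delta_sub \<theta> l) SL2"
  unfolding Delta_sub_def by (rule group.generate_is_subgroup[OF group_SL2]) auto

lemma Delta_sub_dense:
  assumes irrational: "\<theta> / (2 * pi) \<notin> \<rat>" and l: "l > 0"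
  shows "carrier SL2 \<subseteq> closure (Delta_sub \<theta> l)"
proof
  fix A assume A: "A \<in> carrier SL2"
  let ?H = "closure (Delta_sub \<theta> l)"
  have mult: "x ** y \<in> Delta_sub \<theta> l" if "x \<in> Delta_sub \<theta> l" "y \<in> Delta_sub \<theta> l" for x y
    using subgroup.m_closed[OF subgroup_Delta_sub that] by simp
  have gens: "rot \<theta> \<in> Delta_sub \<theta> l" "hyp l \<in> Delta_sub \<theta> l"
    unfolding Delta_sub_def by (simp_all add: generate.incl)
  have one: "mat 1 \<in> Delta_sub \<theta> l"
    using subgroup.one_closed[OF subgroup_Delta_sub] by simp
  have rot: "rot \<alpha> \<in> ?H" for \<alpha>
  proof -
    have "rot (real k * \<theta>) \<in> Delta_sub \<theta> l" for k :: nat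
    proof (induction k)
      case (Suc k)
      then show ?case
        using mult[OF gens(1) Suc] by (simp add: rot_mult distrib_right)
    qed (simp add: one rot_0)
    then have "closure (range (\<lambda>k::nat. rot (real k * \<theta>))) \<subseteq> ?H"
      by (intro closure_mono) auto
    then show ?thesis using rot_powers_dense[OF irrational] by blast
  qed
  have mult_H: "x ** y \<in> ?H" if "x \<in> ?H" "y \<in> ?H" for x y
  proof -
    obtain f where f: "\<forall>n. f n \<in> Delta_sub \<theta> l" "f \<longlonglongrightarrow> x"
      using \<open>x \<in> ?H\<close> unfolding closure_sequential by blast
    obtain g where g: "\<forall>n. g n \<in> Delta_sub \<theta> l" "g \<longlonglongrightarrow> y"
      using \<open>y \<in> ?H\<close> unfolding closure_sequential by blast
    have "(\<lambda>n. f n ** g n) \<longlonglongrightarrow> x ** y"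
      by (rule bounded_bilinear.tendsto[OF bounded_bilinear_matrix_mult f(2) g(2)])
    moreover have "\<forall>n. f n ** g n \<in> Delta_sub \<theta> l"
      using mult f(1) g(1) by blast
    ultimately show ?thesis
      unfolding closure_sequential by (intro exI[of _ "\<lambda>n. f n ** g n"]) simp
  qed
  have hyp: "hyp l \<in> ?H"
    using gens(2) closure_subset by blast
  have "det A = 1" using A by simp
  with mult_H rot hyp l show "A \<in> ?H"
    by (rule SL2_generated_by_rotations_and_hyp)
qed


section \<open>A free semigroup in Gamma\<close>

lemma subgroup_Gamma_sub: "subgroup (Gamma_sub \<theta> l) (SL2 \<times>\<times> SL2)"
  unfolding Gamma_sub_def
  by (rule group.generate_is_subgroup[OF DirProd_group[OF group_SL2 group_SL2]]) auto

lemma Gamma_sub_det: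
  assumes "(x, y) \<in> Gamma_sub \<theta> l"
  shows "det x = 1" "det y = 1"
  using subgroup.mem_carrier[OF subgroup_Gamma_sub assms] by simp_all

lemma Gamma_sub_mult:
  assumes "(x, y) \<in> Gamma_sub \<theta> l" "(x', y') \<in> Gamma_sub \<theta> l"
  shows "(x ** x', y ** y') \<in> Gamma_sub \<theta> l"
  using subgroup.m_closed[OF subgroup_Gamma_sub assms] by simp

lemma Gamma_sub_adj2:
  assumes "(x, y) \<in> Gamma_sub \<theta> l"
  shows "(adj2 x, adj2 y) \<in> Gamma_sub \<theta> l"
  using subgroup.m_inv_closed[OF subgroup_Gamma_sub assms] Gamma_sub_det[OF assms]
  by (simp add: inv_DirProd[OF group_SL2 group_SL2] inv_SL2)

lemma Gamma_sub_one: "(mat 1, mat 1) \<in> Gamma_sub \<theta> l"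
  using subgroup.one_closed[OF subgroup_Gamma_sub] by simp

lemma Gamma_sub_gens:
  "(rot \<theta>, hyp l) \<in> Gamma_sub \<theta> l" "(hyp l, rot \<theta>) \<in> Gamma_sub \<theta> l"
  unfolding Gamma_sub_def by (simp_all add: generate.incl)

lemma Gamma_sub_hyp_power: "(hyp (real k * l), rot (real k * \<theta>)) \<in> Gamma_sub \<theta> l"
proof (induction k)
  case 0
  show ?case by (simp add: hyp_0 rot_0 Gamma_sub_one)
next
  case (Suc k)
  then show ?case
    using Gamma_sub_mult[OF Gamma_sub_gens(2) Suc] by (simp add: hyp_mult rot_mult distrib_right)
qed

text \<open>
  Conjugating \<open>hyp l\<close> by the rotation by \<open>\<phi>\<close> gives off-diagonal entries \<open>sin \<phi> * cos \<phi> * (exp l - exp (- l))\<close>,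
  so one of \<open>\<phi> = \<theta>\<close> and \<open>\<phi> = - \<theta>\<close> makes all the entries positive.
\<close>

lemma Gamma_sub_positive_element:
  assumes sin: "sin (2 * \<theta>) \<noteq> 0" and l: "l > 0"
  obtains s s' where "(s, s') \<in> Gamma_sub \<theta> l" "\<And>i j. s $ i $ j > 0"
proof -
  define \<phi> where "\<phi> = (if sin (2 * \<theta>) > 0 then \<theta> else - \<theta>)"
  have "sin (2 * \<phi>) > 0"
    using sin by (auto simp: \<phi>_def)
  then have "2 * (sin \<phi> * cos \<phi>) > 0"
    by (simp only: sin_double mult.assoc)
  then have sc: "sin \<phi> * cos \<phi> > 0" by linarith
  then have nz: "sin \<phi> \<noteq> 0" "cos \<phi> \<noteq> 0" by auto
  have "(rot \<theta>, hyp l) \<in> Gamma_sub \<theta> l" "(rot (- \<theta>), adj2 (hyp l)) \<in> Gamma_sub \<theta> l"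
    using Gamma_sub_gens(1) Gamma_sub_adj2[OF Gamma_sub_gens(1)] by (simp_all add: adj2_rot)
  then have "\<exists>y. (rot \<phi>, y) \<in> Gamma_sub \<theta> l"
    by (cases "sin (2 * \<theta>) > 0") (auto simp: \<phi>_def simp del: sin_double)
  then obtain y where y: "(rot \<phi>, y) \<in> Gamma_sub \<theta> l" ..
  let ?s = "rot \<phi> ** hyp l ** rot (- \<phi>)"
  have mem: "(?s, y ** rot \<theta> ** adj2 y) \<in> Gamma_sub \<theta> l"
    using Gamma_sub_mult[OF Gamma_sub_mult[OF y Gamma_sub_gens(2)] Gamma_sub_adj2[OF y]]
    by (simp add: adj2_rot)
  have "?s = mat2 ((cos \<phi>)\<^sup>2 * exp l + (sin \<phi>)\<^sup>2 * exp (- l)) (sin \<phi> * cos \<phi> * (exp l - exp (- l)))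
      (sin \<phi> * cos \<phi> * (exp l - exp (- l))) ((sin \<phi>)\<^sup>2 * exp l + (cos \<phi>)\<^sup>2 * exp (- l))"
    by (simp add: rot_eq hyp_eq power2_eq_square algebra_simps)
  moreover have "exp l - exp (- l) > 0" using l by simp
  ultimately have "?s $ i $ j > 0" for i j
    using sc nz exhaust_2[of i] exhaust_2[of j]
    by (auto intro!: add_pos_pos mult_pos_pos)
  then show ?thesis using that mem by blast
qed

definition word_product :: "(nat \<Rightarrow> real^2^2) \<Rightarrow> nat list \<Rightarrow> real^2^2" where
  "word_product P ks = foldr (\<lambda>k M. P k ** M) ks (mat 1)"

lemma word_product_simps [simp]:
  "word_product P [] = mat 1"
  "word_product P (k # ks) = P k ** word_product P ks"
  by (simp_all add: word_product_def)

lemma det_word_product: "(\<And>k. det (P k) = 1) \<Longrightarrow> det (word_product P ks) = 1"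
  by (induction ks) (simp_all add: det_mul)

lemma norm_word_product:
  assumes "\<And>k. k \<in> set ks \<Longrightarrow> norm (P k) \<le> B"
  shows "norm (word_product P ks) \<le> sqrt 2 * B ^ length ks"
  using assms
proof (induction ks)
  case (Cons k ks)
  have "norm (P k ** word_product P ks) \<le> B * (sqrt 2 * B ^ length ks)"
    using Cons by (intro norm_matrix_mult_le') auto
  then show ?case by (simp add: mult.left_commute)
qed (simp add: norm_mat1)

lemma word_product_Gamma_sub:
  assumes "\<And>k. (P k, P' k) \<in> Gamma_sub \<theta> l"
  shows "(word_product P ks, word_product P' ks) \<in> Gamma_sub \<theta> l"
  by (induction ks) (simp_all add: Gamma_sub_one Gamma_sub_mult assms)

lemma word_product_column:
  assumes "\<And>k x y. x > 0 \<Longrightarrow> y \<ge> 0 \<Longrightarrow>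
      P k $ 1 $ 1 * x + P k $ 1 $ 2 * y > 0 \<and> P k $ 2 $ 1 * x + P k $ 2 $ 2 * y \<ge> 0"
  shows "word_product P ks $ 1 $ 1 > 0 \<and> word_product P ks $ 2 $ 1 \<ge> 0"
  by (induction ks) (simp_all add: mat_def matrix_matrix_mult_def sum_2 assms)

text \<open>
  Ping-pong: the hypotheses say that \<open>P k\<close> maps the quadrant \<open>x > 0\<close>, \<open>y \<ge> 0\<close> into its vectors with slope
  in \<open>J k\<close>. The first column of a word is the image of \<open>(1, 0)\<close>, so its slope reveals the first letter,
  which can then be cancelled.
\<close>

lemma word_product_inj:
  assumes det: "\<And>k. det (P k) = 1"
    and cone: "\<And>k x y. x > 0 \<Longrightarrow> y \<ge> 0 \<Longrightarrow>
      P k $ 1 $ 1 * x + P k $ 1 $ 2 * y > 0 \<and> P k $ 2 $ 1 * x + P k $ 2 $ 2 * y \<ge> 0"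
    and slope: "\<And>k x y. x > 0 \<Longrightarrow> y \<ge> 0 \<Longrightarrow>
      (P k $ 2 $ 1 * x + P k $ 2 $ 2 * y) / (P k $ 1 $ 1 * x + P k $ 1 $ 2 * y) \<in> J k"
    and disj: "\<And>k k'. k \<noteq> k' \<Longrightarrow> J k \<inter> J k' = {}"
    and "length ks = length ks'" "word_product P ks = word_product P ks'"
  shows "ks = ks'"
  using assms(5,6)
proof (induction rule: list_induct2)
  case (Cons k ks k' ks')
  have column: "word_product P ks $ 1 $ 1 > 0" "word_product P ks $ 2 $ 1 \<ge> 0" for ks
    using word_product_column[of P] cone by blast+
  have "word_product P (k # ks) $ 2 $ 1 / word_product P (k # ks) $ 1 $ 1 \<in> J k"
    for k ks
    using slope[OF column, of k ks]
    by (simp add: matrix_matrix_mult_def sum_2)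
  then have "J k \<inter> J k' \<noteq> {}"
    using Cons.prems by (metis disjoint_iff)
  then have "k = k'" using disj by blast
  moreover have "word_product P ks = word_product P ks'"
    using matrix_mult_cancel_left[OF det[of k]] Cons.prems \<open>k = k'\<close> by simp
  ultimately show ?case using Cons.IH by simp
qed simp

text \<open>
  The entries of the matrices lie in \<open>[-b, b]\<close>; rounding \<open>T\<close> times each of them down to an integer leaves
  \<open>2 * T * b + 1\<close> values for each of the four.
\<close>

lemma pigeonhole_matrices:
  fixes f :: "'a \<Rightarrow> real^2^2" and b T :: nat
  assumes A: "finite A" "\<And>x. x \<in> A \<Longrightarrow> norm (f x) \<le> real b"
    and T: "T > 0" and card: "card A > (2 * T * b + 1) ^ 4"
  obtains x y where "x \<in> A" "y \<in> A" "x \<noteq> y" "norm (f x - f y) \<le> 2 / real T"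
proof -
  let ?J = "{- int (T * b)..int (T * b)}"
  define cell where "cell x i j = \<lfloor>real T * f x $ i $ j\<rfloor>" for x i j
  define g where "g x = ((cell x 1 1, cell x 1 2), (cell x 2 1, cell x 2 2))" for x
  have cell: "cell x i j \<in> ?J" if "x \<in> A" for x i j
  proof -
    have "\<bar>f x $ i $ j\<bar> \<le> real b"
      by (rule order_trans[OF component_le_norm_cart order_trans[OF Finite_Cartesian_Product.norm_nth_le A(2)[OF that]]])
    then have "\<bar>real T * f x $ i $ j\<bar> \<le> real T * real b"
      by (simp add: abs_mult mult_left_mono)
    then show ?thesis
      by (auto simp: cell_def abs_le_iff le_floor_iff floor_le_iff)
  qed
  have "card ?J = 2 * T * b + 1"
    by (simp add: nat_eq_iff)
  then have cardJ: "card ((?J \<times> ?J) \<times> (?J \<times> ?J)) = (2 * T * b + 1) ^ 4"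
    by (simp only: card_cartesian_product power4_eq_xxxx mult.assoc)
  have "g ` A \<subseteq> (?J \<times> ?J) \<times> (?J \<times> ?J)"
    using cell by (auto simp: g_def)
  then have "card (g ` A) \<le> card ((?J \<times> ?J) \<times> (?J \<times> ?J))"
    by (intro card_mono) auto
  then have "\<not> inj_on g A"
    using card cardJ by (intro pigeonhole) simp
  then obtain x y where xy: "x \<in> A" "y \<in> A" "x \<noteq> y" "g x = g y"
    by (auto simp: inj_on_def)
  have close: "((f x - f y) $ i $ j)\<^sup>2 \<le> (1 / real T)\<^sup>2" for i j
  proof -
    have "cell x i j = cell y i j"
      using xy(4) exhaust_2[of i] exhaust_2[of j] by (auto simp: g_def)
    then have "\<bar>real T * f x $ i $ j - real T * f y $ i $ j\<bar> < 1"
      unfolding cell_def by linarith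
    then have "real T * \<bar>(f x - f y) $ i $ j\<bar> \<le> 1"
      by (simp add: abs_mult right_diff_distrib [symmetric])
    then have "\<bar>(f x - f y) $ i $ j\<bar> \<le> 1 / real T"
      using T by (simp add: field_simps)
    then show ?thesis
      by (metis abs_ge_zero power2_abs power_mono)
  qed
  have "(norm (f x - f y))\<^sup>2 \<le> (2 / real T)\<^sup>2"
  proof (cases "f x - f y" rule: mat2_cases)
    case (mat2 a b c d)
    then show ?thesis
      using close[of 1 1] close[of 1 2] close[of 2 1] close[of 2 2]
      by (simp add: norm_mat2 power_divide)
  qed
  then have "norm (f x - f y) \<le> 2 / real T"
    by (rule power2_le_imp_le) simp
  then show ?thesis using that xy by blast
qed


lemma sin_double_nonzero:
  assumes "\<theta> / (2 * pi) \<notin> \<rat>"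
  shows "sin (2 * \<theta>) \<noteq> 0"
proof
  assume "sin (2 * \<theta>) = 0"
  then obtain i :: int where "2 * \<theta> = of_int i * pi"
    using sin_zero_iff_int2 by blast
  then have *: "\<theta> = of_int i / of_int 4 * (2 * pi)" by (simp add: mult.commute)
  have "\<theta> / (2 * pi) = of_int i / of_int 4"
    unfolding * by (rule nonzero_mult_div_cancel_right) simp
  then show False using assms by (metis Rats_divide Rats_of_int)
qed

text \<open>
  The matrix \<open>s\<close> maps the quadrant into the slopes between \<open>p\<close> and \<open>q\<close>, and \<open>hyp L\<close> multiplies slopes by
  \<open>exp (- 2 * L)\<close>. Choosing \<open>N\<close> with \<open>exp (2 * N * l) > q / p\<close> makes the resulting intervals disjoint.
  The bound \<open>B\<close> on the second coordinates is uniform in \<open>k\<close>, and it is this uniformity that lets the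
  number of letters be increased freely in the counting argument.
\<close>

lemma Gamma_sub_free_semigroup:
  assumes irrational: "\<theta> / (2 * pi) \<notin> \<rat>" and l: "l > 0"
  obtains P P' :: "nat \<Rightarrow> real^2^2" and B :: nat
  where "\<And>k. (P k, P' k) \<in> Gamma_sub \<theta> l" "B \<ge> 1" "\<And>k. norm (P' k) \<le> real B"
    "\<And>ks. word_product P ks $ 1 $ 1 > 0"
    "\<And>ks ks'. length ks = length ks' \<Longrightarrow> word_product P ks = word_product P ks' \<Longrightarrow> ks = ks'"
proof -
  obtain s s' where s: "(s, s') \<in> Gamma_sub \<theta> l" and pos: "\<And>i j. s $ i $ j > 0"
    using Gamma_sub_positive_element[OF sin_double_nonzero[OF irrational] l] by metis
  define p q where "p = s $ 2 $ 1 / s $ 1 $ 1" and "q = s $ 2 $ 2 / s $ 1 $ 2"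
  have "p > 0" "q > 0" using pos by (simp_all add: p_def q_def)
  have "s $ 1 $ 1 * s $ 2 $ 2 - s $ 1 $ 2 * s $ 2 $ 1 = 1"
    using Gamma_sub_det(1)[OF s] by (simp add: det_2)
  then have pq: "p < q" using pos by (simp add: p_def q_def field_simps)
  obtain N :: nat where N: "real N * (2 * l) > ln (q / p)"
    using l ex_less_of_nat_mult[of "2 * l" "ln (q / p)"] by auto
  define L where "L k = real (N * k) * l" for k
  define P where "P k = hyp (L k) ** s" for k
  define P' where "P' k = rot (real (N * k) * \<theta>) ** s'" for k
  have entry: "P k $ 1 $ j = exp (L k) * s $ 1 $ j" "P k $ 2 $ j = exp (- L k) * s $ 2 $ j" for k j
    by (simp_all add: P_def hyp_eq matrix_matrix_mult_def sum_2)
  have \<Gamma>: "(P k, P' k) \<in> Gamma_sub \<theta> l" for k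
    unfolding P_def P'_def L_def by (intro Gamma_sub_mult Gamma_sub_hyp_power s)
  have det: "det (P k) = 1" for k
    using Gamma_sub_det(1)[OF \<Gamma>] .
  have top: "s $ 1 $ 1 * x + s $ 1 $ 2 * y > 0" and bot: "s $ 2 $ 1 * x + s $ 2 $ 2 * y > 0"
    if "x > 0" "y \<ge> 0" for x y
    by (intro add_pos_nonneg mult_pos_pos mult_nonneg_nonneg less_imp_le pos that)+
  have coneE: "P k $ 1 $ 1 * x + P k $ 1 $ 2 * y = exp (L k) * (s $ 1 $ 1 * x + s $ 1 $ 2 * y)"
    "P k $ 2 $ 1 * x + P k $ 2 $ 2 * y = exp (- L k) * (s $ 2 $ 1 * x + s $ 2 $ 2 * y)" for k x y
    by (simp_all add: entry algebra_simps)
  have cone: "P k $ 1 $ 1 * x + P k $ 1 $ 2 * y > 0 \<and> P k $ 2 $ 1 * x + P k $ 2 $ 2 * y \<ge> 0"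
    if "x > 0" "y \<ge> 0" for k x y
    unfolding coneE using top[OF that] bot[OF that] by simp
  \<comment> \<open>The intervals are half-open because the ratio \<open>p\<close> of the first column is attained at \<open>y = 0\<close>.\<close>
  define J where "J k = {exp (- 2 * L k) * p ..< exp (- 2 * L k) * q}" for k
  have slope: "(P k $ 2 $ 1 * x + P k $ 2 $ 2 * y) / (P k $ 1 $ 1 * x + P k $ 1 $ 2 * y) \<in> J k"
    if xy: "x > 0" "y \<ge> 0" for k x y
  proof -
    have sl: "s $ 2 $ 1 = p * s $ 1 $ 1" "s $ 2 $ 2 = q * s $ 1 $ 2"
      using pos[of 1 1] pos[of 1 2] by (simp_all add: p_def q_def)
    define z where "z = (s $ 2 $ 1 * x + s $ 2 $ 2 * y) / (s $ 1 $ 1 * x + s $ 1 $ 2 * y)"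
    have "p * (s $ 1 $ 1 * x + s $ 1 $ 2 * y) \<le> s $ 2 $ 1 * x + s $ 2 $ 2 * y"
      unfolding sl using pq pos[of 1 2] xy by (simp add: algebra_simps mult_left_mono mult_right_mono)
    then have "p \<le> z"
      using top[OF xy] by (simp add: z_def pos_le_divide_eq)
    moreover have "s $ 2 $ 1 * x + s $ 2 $ 2 * y < q * (s $ 1 $ 1 * x + s $ 1 $ 2 * y)"
    proof -
      have "p * (s $ 1 $ 1 * x) < q * (s $ 1 $ 1 * x)"
        using pq pos[of 1 1] xy by (intro mult_strict_right_mono) auto
      then show ?thesis unfolding sl by (simp add: algebra_simps)
    qed
    then have "z < q"
      using top[OF xy] by (simp add: z_def pos_divide_less_eq)
    moreover have "(P k $ 2 $ 1 * x + P k $ 2 $ 2 * y) / (P k $ 1 $ 1 * x + P k $ 1 $ 2 * y)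
        = exp (- 2 * L k) * z"
    proof -
      have "exp (- 2 * L k) = exp (- L k) / exp (L k)"
        by (simp add: exp_diff [symmetric])
      then show ?thesis unfolding coneE z_def by simp
    qed
    ultimately show ?thesis by (simp add: J_def)
  qed
  have sep: "exp (- 2 * L k') * q \<le> exp (- 2 * L k) * p" if "k < k'" for k k'
  proof -
    have "real N * (2 * l) * 1 \<le> real N * (2 * l) * (real k' - real k)"
      using that l by (intro mult_left_mono) auto
    then have "ln (q / p) \<le> 2 * L k' - 2 * L k"
      using N by (simp add: L_def algebra_simps)
    then have "q / p \<le> exp (2 * L k' - 2 * L k)"
      using \<open>p > 0\<close> \<open>q > 0\<close> by (metis divide_pos_pos exp_le_cancel_iff exp_ln)
    then have "exp (- 2 * L k') * (q / p) \<le> exp (- 2 * L k') * exp (2 * L k' - 2 * L k)"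
      by (intro mult_left_mono) auto
    also have "\<dots> = exp (- 2 * L k)"
      by (simp add: exp_add [symmetric])
    finally show ?thesis using \<open>p > 0\<close> by (simp add: field_simps)
  qed
  have disj: "J k \<inter> J k' = {}" if "k \<noteq> k'" for k k'
    using that sep[of k k'] sep[of k' k] unfolding J_def by (cases k k' rule: linorder_cases) auto
  obtain B0 :: nat where B0: "sqrt 2 * norm s' \<le> real B0"
    using real_arch_simple by blast
  show ?thesis
  proof (rule that[of P P' "B0 + 1", OF \<Gamma>])
    show "B0 + 1 \<ge> 1" by simp
    show "norm (P' k) \<le> real (B0 + 1)" for k
      using norm_matrix_mult_le[of "rot (real (N * k) * \<theta>)" s'] B0 by (simp add: P'_def norm_rot)
    show "word_product P ks $ 1 $ 1 > 0" for ks
      using word_product_column[of P] cone by blast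
    show "ks = ks'" if "length ks = length ks'" "word_product P ks = word_product P ks'" for ks ks'
      using word_product_inj[OF det cone slope disj that] by blast
  qed
qed

section \<open>Second coordinates exponentially close to the identity\<close>

text \<open>
  Of the \<open>K ^ n\<close> words of length \<open>n\<close>, two have second coordinates within \<open>2 / T\<close> of each other once
  \<open>K ^ n\<close> exceeds the number of cells, which is at most \<open>((17 * B\<^sup>2 * D) ^ 4) ^ n\<close>. The pair sought is the
  quotient of these two words. Its first coordinate differs from \<open>mat 1\<close> because the words are distinct,
  and from \<open>- mat 1\<close> because the upper left entries of both words are positive.
\<close>

lemma Gamma_sub_small_second_coordinate:
  fixes D :: nat
  assumes irrational: "\<theta> / (2 * pi) \<notin> \<rat>" and l: "l > 0" and D: "D \<ge> 1"
  obtains E :: real where "E \<ge> 1"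
    "\<And>n. n \<ge> 1 \<Longrightarrow> \<exists>x y. (x, y) \<in> Gamma_sub \<theta> l \<and> x \<noteq> mat 1 \<and> x \<noteq> - mat 1 \<and>
      norm x \<le> E ^ n \<and> norm (y - mat 1) \<le> 1 / real D ^ n"
proof -
  obtain P P' B where \<Gamma>: "\<And>k. (P k, P' k) \<in> Gamma_sub \<theta> l"
    and B: "B \<ge> 1" "\<And>k. norm (P' k) \<le> real B"
    and pos: "\<And>ks. word_product P ks $ 1 $ 1 > 0"
    and inj: "\<And>ks ks'. length ks = length ks' \<Longrightarrow> word_product P ks = word_product P ks' \<Longrightarrow> ks = ks'"
    using Gamma_sub_free_semigroup[OF irrational l] by metis
  have det: "det (P k) = 1" "det (P' k) = 1" for k
    using Gamma_sub_det[OF \<Gamma>] by auto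
  define K where "K = (17 * B\<^sup>2 * D) ^ 4 + 1"
  define E0 where "E0 = 1 + (\<Sum>k<K. norm (P k))"
  have E0: "norm (P k) \<le> E0" if "k < K" for k
    using that member_le_sum[of k "{..<K}" "\<lambda>k. norm (P k)"] by (simp add: E0_def)
  have "E0 \<ge> 1" by (simp add: E0_def sum_nonneg)
  define E where "E = 2 * E0\<^sup>2"
  have sqrt2: "sqrt 2 \<le> (2::real)" by (rule real_le_lsqrt) auto
  have "\<exists>x y. (x, y) \<in> Gamma_sub \<theta> l \<and> x \<noteq> mat 1 \<and> x \<noteq> - mat 1 \<and>
      norm x \<le> E ^ n \<and> norm (y - mat 1) \<le> 1 / real D ^ n" if n: "n \<ge> 1" for n
  proof -
    let ?A = "{ks. set ks \<subseteq> {..<K} \<and> length ks = n}"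
    define b where "b = 2 * B ^ n"
    \<comment> \<open>Passing to the quotient costs a factor \<open>b\<close>, and \<open>b * (2 / T)\<close> is to be \<open>1 / D ^ n\<close>.\<close>
    define T where "T = 2 * b * D ^ n"
    have "b > 0" "T > 0" using B(1) D by (auto simp: b_def T_def)
    have bound: "norm (word_product P' ks) \<le> real b" if "ks \<in> ?A" for ks
    proof -
      have "norm (word_product P' ks) \<le> sqrt 2 * real B ^ length ks"
        by (intro norm_word_product B)
      also have "\<dots> \<le> 2 * real B ^ length ks"
        using sqrt2 by (intro mult_right_mono) auto
      finally show ?thesis using that by (simp add: b_def)
    qed
    have "2 * T * b + 1 = 16 * (B\<^sup>2 * D) ^ n + 1"
      by (simp add: T_def b_def power_mult_distrib power2_eq_square algebra_simps)
    also have "\<dots> \<le> 17 * (B\<^sup>2 * D) ^ n"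
      using B(1) D by simp
    also have "\<dots> \<le> 17 ^ n * (B\<^sup>2 * D) ^ n"
      using n self_le_power[of "17::nat" n] by (intro mult_right_mono) auto
    finally have "2 * T * b + 1 \<le> (17 * B\<^sup>2 * D) ^ n"
      by (simp add: power_mult_distrib mult.assoc)
    then have "(2 * T * b + 1) ^ 4 \<le> ((17 * B\<^sup>2 * D) ^ n) ^ 4"
      by (rule power_mono) simp
    also have "\<dots> = ((17 * B\<^sup>2 * D) ^ 4) ^ n"
      by (simp only: power_mult [symmetric] mult.commute)
    also have "\<dots> < K ^ n"
      unfolding K_def using n by (intro power_strict_mono) auto
    also have "\<dots> = card ?A"
      by (simp add: card_lists_length_eq)
    finally have card: "(2 * T * b + 1) ^ 4 < card ?A" .
    have "finite ?A" by (rule finite_lists_length_eq) simp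
    then obtain ks ks' where ks: "ks \<in> ?A" "ks' \<in> ?A" "ks \<noteq> ks'"
      and close: "norm (word_product P' ks - word_product P' ks') \<le> 2 / real T"
      by (rule pigeonhole_matrices[where f = "word_product P'" and b = b and T = T])
        (erule bound, rule \<open>T > 0\<close>, rule card, blast)
    define x y where "x = adj2 (word_product P ks) ** word_product P ks'"
      and "y = adj2 (word_product P' ks) ** word_product P' ks'"
    have dets: "det (word_product P ks) = 1" "det (word_product P' ks) = 1"
      using det_word_product det by blast+
    have "(x, y) \<in> Gamma_sub \<theta> l"
      unfolding x_def y_def
      by (intro Gamma_sub_mult Gamma_sub_adj2 word_product_Gamma_sub \<Gamma>)
    moreover have wx: "word_product P ks' = word_product P ks ** x"
      by (simp add: x_def matrix_mul_assoc adj2_mult dets)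
    have "x \<noteq> mat 1"
      using inj[of ks ks'] ks wx by auto
    moreover have "x \<noteq> - mat 1"
    proof
      assume "x = - mat 1"
      then have "word_product P ks' $ 1 $ 1 = - (word_product P ks $ 1 $ 1)"
        by (simp add: wx matrix_matrix_mult_def sum_2 mat_def)
      then show False using pos[of ks] pos[of ks'] by simp
    qed
    moreover have "norm x \<le> E ^ n"
    proof -
      have "norm (word_product P ks'') \<le> sqrt 2 * E0 ^ n" if "ks'' \<in> ?A" for ks''
        using norm_word_product[of ks'' P E0] E0 that by auto
      then have "norm x \<le> (sqrt 2 * E0 ^ n) * (sqrt 2 * E0 ^ n)"
        unfolding x_def using ks by (intro norm_matrix_mult_le') simp_all
      also have "\<dots> = 2 * (E0\<^sup>2) ^ n"
        by (simp add: power2_eq_square power_mult_distrib)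
      also have "\<dots> \<le> 2 ^ n * (E0\<^sup>2) ^ n"
        using n self_le_power[of "2::real" n] by (intro mult_right_mono) auto
      finally show ?thesis by (simp add: E_def power_mult_distrib)
    qed
    moreover have "norm (y - mat 1) \<le> 1 / real D ^ n"
    proof -
      have "y - mat 1 = adj2 (word_product P' ks) ** (word_product P' ks' - word_product P' ks)"
        by (simp add: y_def matrix_mult_diff_right adj2_mult dets)
      then have "norm (y - mat 1) \<le> real b * (2 / real T)"
        using norm_matrix_mult_le'[of "adj2 (word_product P' ks)" "real b"] bound[OF ks(1)] close
        by (metis norm_adj2 norm_minus_commute)
      also have "\<dots> = 1 / real D ^ n"
        using \<open>b > 0\<close> by (simp add: T_def)
      finally show ?thesis .
    qed
    ultimately show ?thesis by blast
  qed
  moreover have "E \<ge> 1"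
    using one_le_power[OF \<open>E0 \<ge> 1\<close>, of 2] by (simp add: E_def)
  ultimately show ?thesis using that by blast
qed


section \<open>Commuting matrices and commutators\<close>

lemma SL2_scalar:
  fixes g :: "real^2^2"
  assumes "det g = 1" "g = mat2 a 0 0 a"
  shows "g = mat 1 \<or> g = - mat 1"
proof -
  have "a\<^sup>2 = 1" using assms by (simp add: power2_eq_square)
  then have "a = 1 \<or> a = -1" by (simp add: power2_eq_1_iff)
  then show ?thesis by (auto simp: assms(2) mat1_eq mat2_arith)
qed

text \<open>
  The right-hand side says that the vectors \<open>(b, c, a - d)\<close> and \<open>(q, r, p - s)\<close>, which are the trace-free
  parts, are parallel.
\<close>

lemma mat2_commute_iff:
  "mat2 a b c d ** mat2 p q r s = mat2 p q r s ** mat2 a b c d \<longleftrightarrow>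
    b * r = c * q \<and> (a - d) * q = b * (p - s) \<and> (a - d) * r = c * (p - s)"
  by (simp add: algebra_simps) argo

text \<open>
  Two matrices commute exactly when their trace-free parts are parallel, and the trace-free part of \<open>g\<close>
  is not zero.
\<close>

lemma commute_with_common_nonscalar:
  fixes g x y :: "real^2^2"
  assumes g1: "det g = 1" "g \<noteq> mat 1" "g \<noteq> - mat 1" and gx: "g ** x = x ** g" and gy: "g ** y = y ** g"
  shows "x ** y = y ** x"
proof (cases g rule: mat2_cases)
  case g: (mat2 a b c d)
  obtain p q r s where x: "x = mat2 p q r s" by (rule mat2_cases)
  obtain p' q' r' s' where y: "y = mat2 p' q' r' s'" by (rule mat2_cases)
  note gx = gx [unfolded g x mat2_commute_iff] and gy = gy [unfolded g y mat2_commute_iff]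
  consider "b \<noteq> 0" | "c \<noteq> 0" | "a - d \<noteq> 0"
    using SL2_scalar[OF g1(1), of a] g1(2,3) g by fastforce
  then have "q * r' = r * q' \<and> (p - s) * q' = q * (p' - s') \<and> (p - s) * r' = r * (p' - s')"
  proof cases
    case 1
    then have "r = c / b * q" "r' = c / b * q'" "p - s = (a - d) / b * q" "p' - s' = (a - d) / b * q'"
      using gx gy by (simp_all add: nonzero_eq_divide_eq mult.commute)
    then show ?thesis by simp
  next
    case 2
    then have "q = b / c * r" "q' = b / c * r'" "p - s = (a - d) / c * r" "p' - s' = (a - d) / c * r'"
      using gx gy by (simp_all add: nonzero_eq_divide_eq mult.commute)
    then show ?thesis by simp
  next
    case 3
    then have "q = b / (a - d) * (p - s)" "q' = b / (a - d) * (p' - s')"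
        "r = c / (a - d) * (p - s)" "r' = c / (a - d) * (p' - s')"
      using gx gy by (simp_all add: nonzero_eq_divide_eq mult.commute)
    then show ?thesis by simp
  qed
  then show ?thesis
    unfolding x y mat2_commute_iff .
qed

text \<open>
  Conjugation by \<open>rot \<theta>\<close> rotates the symmetric trace-free part \<open>(p - s, q + r)\<close> of \<open>x\<close> by \<open>2 * \<theta>\<close> and fixes
  the antisymmetric part. If \<open>x\<close> commutes with its conjugate, the symmetric part is parallel to its
  rotation, so it vanishes. An antisymmetric part does not stay antisymmetric under
  conjugation by \<open>hyp l\<close>, so it vanishes as well.
\<close>

lemma central_of_conjugates_commute:
  assumes det: "det x = 1" and sin: "sin (2 * \<theta>) \<noteq> 0" and l: "l > 0"
    and R: "x ** (rot \<theta> ** x ** rot (- \<theta>)) = (rot \<theta> ** x ** rot (- \<theta>)) ** x"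
    and A: "x ** (hyp l ** x ** hyp (- l)) = (hyp l ** x ** hyp (- l)) ** x"
  shows "x = mat 1 \<or> x = - mat 1"
proof (cases x rule: mat2_cases)
  case (mat2 p q r s)
  define C S where "C = cos \<theta>" and "S = sin \<theta>"
  have CS: "C\<^sup>2 + S\<^sup>2 = 1" by (simp add: C_def S_def)
  have rx: "rot \<theta> ** x ** rot (- \<theta>) =
      mat2 (C * (C * p - S * r) - S * (C * q - S * s)) (S * (C * p - S * r) + C * (C * q - S * s))
           (C * (S * p + C * r) - S * (S * q + C * s)) (S * (S * p + C * r) + C * (S * q + C * s))"
    unfolding mat2 rot_eq C_def S_def by (simp add: algebra_simps)
  have "2 * S * C * ((p - s)\<^sup>2 + (q + r)\<^sup>2) = 0"
    using R CS unfolding rx unfolding mat2 mat2_mult mat2_eq_iff by algebra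
  moreover have "2 * S * C \<noteq> 0"
    using sin by (simp add: S_def C_def sin_double)
  ultimately have "(p - s)\<^sup>2 + (q + r)\<^sup>2 = 0" by simp
  then have ps: "s = p" "r = - q"
    by (simp_all add: sum_power2_eq_zero_iff)
  have "hyp l ** x ** hyp (- l) = mat2 p (exp l * exp l * q) (exp (- l) * exp (- l) * r) s"
    unfolding mat2 hyp_eq by (simp add: exp_minus mult.commute mult.left_commute)
  with A have "q * (exp (- l) * exp (- l) * r) = exp (l) * exp l * q * r"
    unfolding mat2 by simp
  then have "q * q * (exp l * exp l - exp (- l) * exp (- l)) = 0"
    unfolding ps by algebra
  moreover have "exp (- l) * exp (- l) < exp l * exp l"
    using l by (simp add: exp_add [symmetric])
  ultimately have "q = 0" by simp
  then have "x = mat2 p 0 0 p" unfolding mat2 ps by simp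
  then show ?thesis by (rule SL2_scalar[OF det])
qed

text \<open>
  The commutator minus the identity is \<open>((x - mat 1) ** y - y ** (x - mat 1)) ** adj2 x ** adj2 y\<close>. The
  bound is linear in the distance of \<open>x\<close> to the identity, with a factor depending on the size of \<open>y\<close>, so
  that it tolerates a large \<open>y\<close>.
\<close>

lemma norm_commutator_le:
  assumes "det x = 1" "det y = 1"
  shows "norm (x ** y ** adj2 x ** adj2 y - mat 1) \<le> 2 * norm (x - mat 1) * norm x * (norm y)\<^sup>2"
proof -
  have "x ** y ** adj2 x ** adj2 y - mat 1 = (x ** y - y ** x) ** (adj2 x ** adj2 y)"
  proof -
    have "y ** x ** (adj2 x ** adj2 y) = y ** (x ** adj2 x) ** adj2 y"
      by (simp add: matrix_mul_assoc)
    also have "\<dots> = mat 1"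
      using assms by (simp add: adj2_mult)
    finally show ?thesis
      by (simp add: matrix_mult_diff_left matrix_mul_assoc)
  qed
  also have "x ** y - y ** x = (x - mat 1) ** y - y ** (x - mat 1)"
    by (simp add: matrix_mult_diff_left matrix_mult_diff_right)
  finally have eq: "x ** y ** adj2 x ** adj2 y - mat 1 =
      ((x - mat 1) ** y - y ** (x - mat 1)) ** (adj2 x ** adj2 y)" .
  have "norm ((x - mat 1) ** y - y ** (x - mat 1)) \<le> norm (x - mat 1) * norm y + norm y * norm (x - mat 1)"
    by (rule order_trans[OF norm_triangle_ineq4 add_mono[OF norm_matrix_mult_le norm_matrix_mult_le]])
  moreover have "norm (adj2 x ** adj2 y) \<le> norm x * norm y"
    using norm_matrix_mult_le[of "adj2 x" "adj2 y"] by simp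
  ultimately have "norm (((x - mat 1) ** y - y ** (x - mat 1)) ** (adj2 x ** adj2 y)) \<le>
      (norm (x - mat 1) * norm y + norm y * norm (x - mat 1)) * (norm x * norm y)"
    by (rule norm_matrix_mult_le')
  then show ?thesis
    unfolding eq by (simp add: power2_eq_square algebra_simps)
qed

lemma commutator_trivial_imp_commute:
  assumes "det x = 1" "det y = 1" "x ** y ** adj2 x ** adj2 y = mat 1"
  shows "x ** y = y ** x"
proof -
  have "x ** y = x ** y ** adj2 x ** (adj2 y ** y) ** x"
    using assms by (simp add: adj2_mult matrix_mul_assoc [symmetric])
  also have "\<dots> = (x ** y ** adj2 x ** adj2 y) ** (y ** x)"
    by (simp add: matrix_mul_assoc)
  finally show ?thesis using assms(3) by simp
qed

section \<open>Lifting words and the gap at the identity\<close>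

text \<open>
  Fixing a lift to \<open>\<Gamma>\<close> of every letter lifts words letter by letter, and the second coordinate grows at
  most exponentially in the length.
\<close>

lemma word_ball_lift:
  assumes S: "finite S" "S \<subseteq> carrier SL2" "generate SL2 S = Delta_sub \<theta> l"
  obtains C :: nat where "C \<ge> 1"
    "\<And>n g. g \<in> word_ball SL2 S n \<Longrightarrow>
      \<exists>g'. (g, g') \<in> Gamma_sub \<theta> l \<and> norm g' \<le> sqrt 2 * real C ^ n"
proof -
  let ?T = "S \<union> m_inv SL2 ` S"
  have "?T \<subseteq> Delta_sub \<theta> l"
    unfolding S(3) [symmetric] by (auto intro: generate.intros)
  then have "\<forall>x\<in>?T. \<exists>x'. (x, x') \<in> Gamma_sub \<theta> l"
    unfolding fst_Gamma_sub [of \<theta> l, symmetric] by force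
  then obtain \<tau> where \<tau>: "\<And>x. x \<in> ?T \<Longrightarrow> (x, \<tau> x) \<in> Gamma_sub \<theta> l"
    by metis
  obtain C0 :: nat where C0: "(\<Sum>x\<in>?T. norm (\<tau> x)) \<le> real C0"
    using real_arch_simple by blast
  have C: "norm (\<tau> x) \<le> real (C0 + 1)" if "x \<in> ?T" for x
    using member_le_sum[of x ?T "\<lambda>x. norm (\<tau> x)"] that S(1) C0 by simp
  have lift: "\<exists>g'. (foldr (\<otimes>\<^bsub>SL2\<^esub>) ws \<one>\<^bsub>SL2\<^esub>, g') \<in> Gamma_sub \<theta> l \<and>
      norm g' \<le> sqrt 2 * real (C0 + 1) ^ length ws" if "set ws \<subseteq> ?T" for ws
    using that
  proof (induction ws)
    case Nil
    show ?case
      using Gamma_sub_one by (intro exI[of _ "mat 1"]) (simp add: norm_mat1)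
  next
    case (Cons x ws)
    then have "set ws \<subseteq> ?T" by simp
    from Cons.IH[OF this]
    obtain g' where g': "(foldr (\<otimes>\<^bsub>SL2\<^esub>) ws \<one>\<^bsub>SL2\<^esub>, g') \<in> Gamma_sub \<theta> l"
        "norm g' \<le> sqrt 2 * real (C0 + 1) ^ length ws"
      by blast
    have x: "x \<in> ?T" using Cons.prems by simp
    have "norm (\<tau> x ** g') \<le> real (C0 + 1) * (sqrt 2 * real (C0 + 1) ^ length ws)"
      by (rule norm_matrix_mult_le'[OF C[OF x] g'(2)])
    also have "\<dots> = sqrt 2 * real (C0 + 1) ^ length (x # ws)"
      by (simp add: mult.left_commute)
    finally have "norm (\<tau> x ** g') \<le> sqrt 2 * real (C0 + 1) ^ length (x # ws)" .
    moreover have "(foldr (\<otimes>\<^bsub>SL2\<^esub>) (x # ws) \<one>\<^bsub>SL2\<^esub>, \<tau> x ** g') \<in> Gamma_sub \<theta> l"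
      using Gamma_sub_mult[OF \<tau>[OF x] g'(1)] unfolding foldr_Cons o_apply SL2_simps(2) .
    ultimately show ?case by blast
  qed
  show ?thesis
  proof (rule that[of "C0 + 1"])
    fix n g assume "g \<in> word_ball SL2 S n"
    then obtain ws where ws: "g = foldr (\<otimes>\<^bsub>SL2\<^esub>) ws \<one>\<^bsub>SL2\<^esub>" "set ws \<subseteq> ?T" "length ws \<le> n"
      unfolding word_ball_def by blast
    obtain g' where g': "(g, g') \<in> Gamma_sub \<theta> l" "norm g' \<le> sqrt 2 * real (C0 + 1) ^ length ws"
      using lift[OF ws(2)] ws(1) by blast
    note g'(2)
    also have "sqrt 2 * real (C0 + 1) ^ length ws \<le> sqrt 2 * real (C0 + 1) ^ n"
      using ws(3) by (intro mult_left_mono power_increasing) auto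
    finally show "\<exists>g'. (g, g') \<in> Gamma_sub \<theta> l \<and> norm g' \<le> sqrt 2 * real (C0 + 1) ^ n"
      using g'(1) by blast
  qed simp
qed

lemma one_in_word_ball: "\<one>\<^bsub>G\<^esub> \<in> word_ball G S n"
  unfolding word_ball_def by (rule CollectI, rule exI[of _ "[]"]) simp

lemma discrete_Gamma_sub_gap:
  assumes "discrete (Gamma_sub \<theta> l)"
  obtains e where "e > 0" "\<And>x y. (x, y) \<in> Gamma_sub \<theta> l \<Longrightarrow> norm (x - mat 1) < e \<Longrightarrow>
    norm (y - mat 1) < e \<Longrightarrow> x = mat 1"
proof -
  have "(mat 1, mat 1) isolated_in Gamma_sub \<theta> l"
    using assms Gamma_sub_one by (rule discreteD)
  then obtain e where e: "e > 0"
    "\<And>z. z \<in> Gamma_sub \<theta> l \<Longrightarrow> dist (mat 1, mat 1) z < e \<Longrightarrow> z = (mat 1, mat 1)"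
    unfolding isolated_in_dist_Ex_iff by blast
  have "x = mat 1" if "(x, y) \<in> Gamma_sub \<theta> l" "norm (x - mat 1) < e / 2" "norm (y - mat 1) < e / 2" for x y
  proof -
    have "dist (mat 1, mat 1) (x, y) \<le> dist (mat 1) x + dist (mat 1) y"
      by (simp add: dist_Pair_Pair sqrt_sum_squares_le_sum)
    also have "\<dots> < e"
      using that by (simp add: dist_norm norm_minus_commute)
    finally show ?thesis using e(2) that(1) by blast
  qed
  then show ?thesis using that[of "e / 2"] e(1) by simp
qed


text \<open>
  The exponent \<open>2 * ln E + 1\<close> is the rate \<open>c\<close> of the final estimate: the square of \<open>E ^ n\<close> enters through
  the commutator bound for the first coordinate.
\<close>

lemma exp_bound_of_power:
  assumes "E \<ge> (1::real)"
  shows "exp (- (2 * ln E + 1) * real n) * (E ^ n)\<^sup>2 \<le> 1"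
proof -
  have "E ^ n = exp (real n * ln E)"
    using assms by (simp add: exp_of_nat_mult)
  then have "(E ^ n)\<^sup>2 = exp (2 * ln E * real n)"
    by (simp add: power2_eq_square exp_add [symmetric] algebra_simps)
  then have "exp (- (2 * ln E + 1) * real n) * (E ^ n)\<^sup>2 = exp (- real n)"
    by (simp add: exp_add [symmetric] algebra_simps)
  then show ?thesis by simp
qed

lemma norm_conjugate_le:
  assumes "norm h \<le> H" "norm x \<le> b"
  shows "norm (h ** x ** adj2 h) \<le> H\<^sup>2 * b"
proof -
  have "norm (h ** x ** adj2 h) \<le> (H * b) * H"
    using assms by (intro norm_matrix_mult_le') simp_all
  then show ?thesis by (simp add: power2_eq_square mult.commute mult.left_commute)
qed

text \<open>
  In the first coordinate \<open>g\<close> is the element close to the identity, in the second \<open>x'\<close> is. The commutator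
  bound serves for both, since inverting a commutator exchanges the roles of its two entries.
\<close>

lemma Gamma_sub_commute_if_small:
  assumes gap: "\<And>x y. (x, y) \<in> Gamma_sub \<theta> l \<Longrightarrow> norm (x - mat 1) < \<epsilon> \<Longrightarrow>
      norm (y - mat 1) < \<epsilon> \<Longrightarrow> x = mat 1"
    and g: "(g, g') \<in> Gamma_sub \<theta> l" and x: "(x, x') \<in> Gamma_sub \<theta> l"
    and small: "2 * norm (g - mat 1) * norm g * (norm x)\<^sup>2 < \<epsilon>"
      "2 * norm (x' - mat 1) * norm x' * (norm g')\<^sup>2 < \<epsilon>"
  shows "g ** x = x ** g"
proof -
  note dets = Gamma_sub_det[OF g] Gamma_sub_det[OF x]
  have "(g ** x ** adj2 g ** adj2 x, g' ** x' ** adj2 g' ** adj2 x') \<in> Gamma_sub \<theta> l"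
    by (intro Gamma_sub_mult Gamma_sub_adj2 g x)
  moreover have "norm (g ** x ** adj2 g ** adj2 x - mat 1) < \<epsilon>"
    using norm_commutator_le[of g x] dets small(1) by simp
  moreover have "norm (g' ** x' ** adj2 g' ** adj2 x' - mat 1) < \<epsilon>"
  proof -
    let ?z = "x' ** g' ** adj2 x' ** adj2 g' - mat 1"
    have adj: "adj2 (A ** B) = adj2 B ** adj2 A" for A B
      by (cases A rule: mat2_cases; cases B rule: mat2_cases) (simp add: algebra_simps)
    have "adj2 ?z = g' ** x' ** adj2 g' ** adj2 x' - mat 1"
    proof -
      have "adj2 (A - B) = adj2 A - adj2 B" "adj2 (adj2 A) = A" "adj2 (mat 1) = mat 1" for A B
        by (cases A rule: mat2_cases; cases B rule: mat2_cases; simp add: mat2_arith mat1_eq)+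
      then show ?thesis by (simp add: adj matrix_mul_assoc)
    qed
    then have "norm (g' ** x' ** adj2 g' ** adj2 x' - mat 1) = norm ?z"
      by (metis norm_adj2)
    then show ?thesis
      using norm_commutator_le[of x' g'] dets small(2) by simp
  qed
  ultimately have "g ** x ** adj2 g ** adj2 x = mat 1"
    by (rule gap)
  then show ?thesis
    using commutator_trivial_imp_commute dets by blast
qed

text \<open>
  The order in which the constants are chosen matters: \<open>\<epsilon>\<close> from discreteness and \<open>C\<close> from the generating
  set come first, then \<open>D\<close> large enough for the second coordinate of the commutator, which determines
  \<open>E\<close>, and finally \<open>c\<close> and \<open>\<rho>\<close> to control the first coordinate.
\<close>

lemma Delta_sub_word_gap:
  assumes irrational: "\<theta> / (2 * pi) \<notin> \<rat>" and l: "l > 0"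
    and disc: "discrete (Gamma_sub \<theta> l)"
    and S: "finite S" "S \<subseteq> carrier SL2" "generate SL2 S = Delta_sub \<theta> l"
  obtains \<rho> c where "\<rho> > 0" "c > 0"
    "\<And>n g. n \<ge> 1 \<Longrightarrow> g \<in> word_ball SL2 S n \<Longrightarrow> norm (g - mat 1) \<le> \<rho> * exp (- c * real n) \<Longrightarrow> g = mat 1"
proof -
  obtain \<epsilon> where \<epsilon>: "\<epsilon> > 0" and gap: "\<And>x y. (x, y) \<in> Gamma_sub \<theta> l \<Longrightarrow> norm (x - mat 1) < \<epsilon> \<Longrightarrow>
      norm (y - mat 1) < \<epsilon> \<Longrightarrow> x = mat 1"
    using discrete_Gamma_sub_gap[OF disc] by blast
  obtain C :: nat where C: "C \<ge> 1" and lift: "\<And>n g. g \<in> word_ball SL2 S n \<Longrightarrow>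
      \<exists>g'. (g, g') \<in> Gamma_sub \<theta> l \<and> norm g' \<le> sqrt 2 * real C ^ n"
    using word_ball_lift[OF S] by blast
  \<comment> \<open>A bound for both coordinates of the three elements by which \<open>(x, y)\<close> is conjugated.\<close>
  define H where "H = 2 + norm (hyp l)"
  have H: "norm (mat 1 :: real^2^2) \<le> H" "norm (rot \<theta>) \<le> H" "norm (hyp l) \<le> H"
    using real_le_lsqrt[of 2 2] by (simp_all add: H_def norm_mat1 norm_rot add_increasing2)
  have "H \<ge> 1" by (simp add: H_def add_increasing2)
  define M where "M = 4 * H\<^sup>2 * (H\<^sup>2 + 2)"
  have "M > 0" using \<open>H \<ge> 1\<close> by (simp add: M_def add_pos_pos)
  obtain m :: nat where m: "M / \<epsilon> < real m"
    using reals_Archimedean2 by blast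
  have "m > 0" using m \<open>M > 0\<close> \<epsilon> by (cases m) (auto simp: divide_less_0_iff)
  \<comment> \<open>The factor \<open>C\<^sup>2\<close> absorbs the square of the norm of \<open>g'\<close>, and \<open>m\<close> the constants.\<close>
  define D where "D = C\<^sup>2 * m"
  have "D \<ge> 1" using C \<open>m > 0\<close> by (simp add: D_def)
  obtain E :: real where E: "E \<ge> 1" and near: "\<And>n. n \<ge> 1 \<Longrightarrow>
      \<exists>x y. (x, y) \<in> Gamma_sub \<theta> l \<and> x \<noteq> mat 1 \<and> x \<noteq> - mat 1 \<and>
        norm x \<le> E ^ n \<and> norm (y - mat 1) \<le> 1 / real D ^ n"
    using Gamma_sub_small_second_coordinate[OF irrational l \<open>D \<ge> 1\<close>] by blast
  define c where "c = 2 * ln E + 1"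
  have "c > 0" using E by (simp add: c_def add_nonneg_pos)
  define \<rho> where "\<rho> = min 1 (\<epsilon> / (12 * H ^ 4))"
  have "H ^ 4 > 0" using \<open>H \<ge> 1\<close> by simp
  then have \<rho>: "\<rho> > 0" "\<rho> \<le> 1" "6 * H ^ 4 * \<rho> < \<epsilon>"
    using \<epsilon> by (auto simp: \<rho>_def min_def field_simps)
  have "g = mat 1" if n: "n \<ge> 1" and g: "g \<in> word_ball SL2 S n"
    and close: "norm (g - mat 1) \<le> \<rho> * exp (- c * real n)" for n g
  proof (rule ccontr)
    assume "g \<noteq> mat 1"
    obtain g' where g': "(g, g') \<in> Gamma_sub \<theta> l" "norm g' \<le> sqrt 2 * real C ^ n"
      using lift[OF g] by blast
    obtain x y where xy: "(x, y) \<in> Gamma_sub \<theta> l" "x \<noteq> mat 1" "x \<noteq> - mat 1"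
        "norm x \<le> E ^ n" "norm (y - mat 1) \<le> 1 / real D ^ n"
      using near[OF n] by blast
    have "exp (- c * real n) \<le> 1" using \<open>c > 0\<close> by simp
    then have g1: "norm (g - mat 1) \<le> 1"
      using close \<rho> by (meson mult_le_one exp_ge_zero order_trans)
    have sqrt2: "sqrt 2 \<le> (2::real)" by (rule real_le_lsqrt) auto
    have ng: "norm g \<le> 3"
      using norm_triangle_sub[of g "mat 1"] g1 sqrt2 by (simp add: norm_mat1)
    have "g \<noteq> - mat 1"
    proof
      assume "g = - mat 1"
      then have "g - mat 1 = - 2 *\<^sub>R mat 1"
        by (simp add: mat1_eq mat2_arith)
      then have "norm (g - mat 1) = 2 * sqrt 2" by (simp add: norm_mat1)
      moreover have "sqrt 2 \<ge> (1::real)" by simp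
      ultimately show False using g1 by linarith
    qed
    have comm: "g ** (h ** x ** adj2 h) = (h ** x ** adj2 h) ** g"
      if h: "(h, h') \<in> Gamma_sub \<theta> l" and nh: "norm h \<le> H" "norm h' \<le> H" for h h'
    proof (rule Gamma_sub_commute_if_small[OF gap g'(1)])
      show "(h ** x ** adj2 h, h' ** y ** adj2 h') \<in> Gamma_sub \<theta> l"
        by (intro Gamma_sub_mult Gamma_sub_adj2 h xy)
      have "norm (h ** x ** adj2 h) \<le> H\<^sup>2 * E ^ n"
        by (rule norm_conjugate_le[OF nh(1) xy(4)])
      then have "(norm (h ** x ** adj2 h))\<^sup>2 \<le> (H\<^sup>2 * E ^ n)\<^sup>2"
        by (intro power_mono) auto
      also have "\<dots> = H ^ 4 * (E ^ n)\<^sup>2"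
        by (simp add: power_mult_distrib power_mult [symmetric])
      finally have "2 * norm (g - mat 1) * norm g * (norm (h ** x ** adj2 h))\<^sup>2 \<le>
          2 * (\<rho> * exp (- c * real n)) * 3 * (H ^ 4 * (E ^ n)\<^sup>2)"
        using close ng \<rho> by (intro mult_mono) auto
      also have "\<dots> = 6 * H ^ 4 * \<rho> * (exp (- c * real n) * (E ^ n)\<^sup>2)"
        by simp
      also have "\<dots> \<le> 6 * H ^ 4 * \<rho> * 1"
        unfolding c_def using exp_bound_of_power[OF E] \<rho> \<open>H ^ 4 > 0\<close> by (intro mult_left_mono) auto
      finally show "2 * norm (g - mat 1) * norm g * (norm (h ** x ** adj2 h))\<^sup>2 < \<epsilon>"
        using \<rho>(3) by linarith
      let ?z = "h' ** y ** adj2 h'"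
      have "?z - mat 1 = h' ** (y - mat 1) ** adj2 h'"
        using Gamma_sub_det(2)[OF h]
        by (simp add: matrix_mult_diff_left matrix_mult_diff_right adj2_mult)
      then have z1: "norm (?z - mat 1) \<le> H\<^sup>2 * (1 / real D ^ n)"
        using norm_conjugate_le[OF nh(2) xy(5)] by simp
      also have "\<dots> \<le> H\<^sup>2 * 1"
        using \<open>D \<ge> 1\<close> by (intro mult_left_mono) (auto simp: field_simps)
      finally have nz: "norm ?z \<le> H\<^sup>2 + 2"
        using norm_triangle_sub[of ?z "mat 1"] sqrt2 by (simp add: norm_mat1)
      have "(norm g')\<^sup>2 \<le> (sqrt 2 * real C ^ n)\<^sup>2"
        using g'(2) by (intro power_mono) auto
      also have "\<dots> = 2 * real (C\<^sup>2) ^ n"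
        by (simp add: power_mult_distrib power_mult [symmetric] mult.commute)
      finally have "2 * norm (?z - mat 1) * norm ?z * (norm g')\<^sup>2 \<le>
          2 * (H\<^sup>2 * (1 / real D ^ n)) * (H\<^sup>2 + 2) * (2 * real (C\<^sup>2) ^ n)"
        using z1 nz by (intro mult_mono) auto
      also have "\<dots> = M * (1 / real m ^ n)"
      proof -
        define K where "K = real (C\<^sup>2) ^ n"
        have "K \<noteq> 0" using C by (simp add: K_def)
        moreover have "real D ^ n = K * real m ^ n"
          by (simp add: D_def K_def power_mult_distrib)
        ultimately show ?thesis
          unfolding K_def [symmetric] by (simp add: M_def)
      qed
      also have "\<dots> \<le> M * (1 / real m)"
        using n \<open>m > 0\<close> \<open>M > 0\<close> self_le_power[of "real m" n]
        by (intro mult_left_mono divide_left_mono) auto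
      also have "\<dots> < \<epsilon>"
        using m \<open>m > 0\<close> \<epsilon> by (simp add: field_simps)
      finally show "2 * norm (?z - mat 1) * norm ?z * (norm g')\<^sup>2 < \<epsilon>" .
    qed
    have detg: "det g = 1" using Gamma_sub_det(1)[OF g'(1)] .
    have "adj2 (mat 1) = mat 1" by (simp add: mat1_eq)
    then have c1: "g ** x = x ** g"
      using comm[OF Gamma_sub_one H(1) H(1)] by simp
    have c2: "g ** (rot \<theta> ** x ** rot (- \<theta>)) = (rot \<theta> ** x ** rot (- \<theta>)) ** g"
      using comm[OF Gamma_sub_gens(1) H(2,3)] by (simp add: adj2_rot)
    have c3: "g ** (hyp l ** x ** hyp (- l)) = (hyp l ** x ** hyp (- l)) ** g"
      using comm[OF Gamma_sub_gens(2) H(3,2)] by (simp add: adj2_hyp)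
    note common = commute_with_common_nonscalar[OF detg \<open>g \<noteq> mat 1\<close> \<open>g \<noteq> - mat 1\<close> c1]
    have "x = mat 1 \<or> x = - mat 1"
      using common[OF c2] common[OF c3]
      by (rule central_of_conjugates_commute[OF Gamma_sub_det(1)[OF xy(1)]
            sin_double_nonzero[OF irrational] l])
    then show False using xy by blast
  qed
  then show ?thesis using that \<rho>(1) \<open>c > 0\<close> by blast
qed

theorem propositionB4:
  fixes \<theta> l :: real and Q :: "real^2^2 \<Rightarrow> real^2^2 \<Rightarrow> real"
  assumes "inner_product_on_sl2 Q"
    and "\<theta> \<in> {0..2 * pi}"
    and "\<theta> / (2 * pi) \<notin> \<rat>"
    and "l > 0"
    and "discrete (Gamma_sub \<theta> l)"
  shows "strongly_diophantine Q (Delta_sub \<theta> l)"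
  unfolding strongly_diophantine_def
proof (intro conjI allI impI)
  show "subgroup (Delta_sub \<theta> l) SL2" by (rule subgroup_Delta_sub)
  show "carrier SL2 \<subseteq> closure (Delta_sub \<theta> l)" by (rule Delta_sub_dense[OF assms(3,4)])
  show "\<exists>S. finite S \<and> S \<subseteq> carrier SL2 \<and> generate SL2 S = Delta_sub \<theta> l"
    by (rule exI[of _ "{rot \<theta>, hyp l}"]) (simp add: Delta_sub_def)
  fix S assume S: "finite S \<and> S \<subseteq> carrier SL2 \<and> generate SL2 S = Delta_sub \<theta> l"
  obtain \<rho> c where \<rho>: "\<rho> > 0" "c > 0" "\<And>n g. n \<ge> 1 \<Longrightarrow> g \<in> word_ball SL2 S n \<Longrightarrow>
      norm (g - mat 1) \<le> \<rho> * exp (- c * real n) \<Longrightarrow> g = mat 1"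
    using Delta_sub_word_gap[OF assms(3-5)] S by blast
  obtain r0 C where C: "r0 > 0" "C > 0"
    "\<And>r h. r \<le> r0 \<Longrightarrow> h \<in> SL2_ball Q (mat 1) r \<Longrightarrow> norm (h - mat 1) \<le> C * r"
    using SL2_ball_norm_bound[OF assms(1)] by blast
  define c1 where "c1 = min r0 (\<rho> / C)"
  have c1: "c1 > 0" "c1 \<le> r0" "C * c1 \<le> \<rho>"
    using \<rho>(1) C(1,2) by (auto simp: c1_def min_def field_simps)
  show "\<exists>c1>0. \<exists>c2>0. \<forall>n\<ge>1. SL2_ball Q \<one>\<^bsub>SL2\<^esub> (c1 * exp (- c2 * real n)) \<inter>
      word_ball SL2 S n = {\<one>\<^bsub>SL2\<^esub>}"
  proof (intro exI conjI allI impI)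
    fix n :: nat assume n: "n \<ge> 1"
    let ?r = "c1 * exp (- c * real n)"
    have "?r \<le> c1 * 1"
      using c1(1) \<rho>(2) by (intro mult_left_mono) auto
    then have r: "?r \<le> r0" using c1(2) by simp
    have "g = mat 1" if "g \<in> SL2_ball Q (mat 1) ?r" "g \<in> word_ball SL2 S n" for g
    proof (rule \<rho>(3)[OF n that(2)])
      have "norm (g - mat 1) \<le> C * ?r"
        by (rule C(3)[OF r that(1)])
      also have "\<dots> \<le> \<rho> * exp (- c * real n)"
        using mult_right_mono[OF c1(3), of "exp (- c * real n)"] by (simp add: mult.assoc)
      finally show "norm (g - mat 1) \<le> \<rho> * exp (- c * real n)" .
    qed
    moreover have "mat 1 \<in> SL2_ball Q (mat 1) ?r"
      using c1(1) by (intro mat1_in_SL2_ball[OF assms(1)]) simp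
    moreover have "mat 1 \<in> word_ball SL2 S n"
      using one_in_word_ball[of SL2 S n] by simp
    ultimately show "SL2_ball Q \<one>\<^bsub>SL2\<^esub> ?r \<inter> word_ball SL2 S n = {\<one>\<^bsub>SL2\<^esub>}"
      by auto
  qed (use c1 \<rho> in auto)
qed

end
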